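(* Let $f$ be any one of the following 10 degree-based topological indices: Gourava1, Gourava2, hGourava1, hGourava2, GouravaPC, InvSumDeg, rRandić, Zagreb2, hZagreb1, hZagreb2. Then the set of chemical graphs that are extremal for $f$ is exactly $F_3\cup F_4$.
   Context: All graphs are finite, simple and undirected. A chemical graph is a connected graph of order (number of vertices) $n\ge 7$, size (number of edges) $m\le \frac{3n-3}{2}$ and maximum degree at most $3$. For such a graph, $x_{ij}$ ($i\le j$) denotes the number of $(i,j)$-edges, i.e. edges whose endpoints have degrees $i$ and $j$ (necessarily $x_{11}=0$). A degree-based topological index is a function of the form $f(G)=c_{12}x_{12}+c_{13}x_{13}+c_{22}x_{22}+c_{23}x_{23}+c_{33}x_{33}$ with real coefficients $c_{ij}$. A chemical graph $G$ is extremal for $f$ if it maximizes $f$ or minimizes $f$ over all chemical graphs of the same order and size as $G$. The indices are given by the following coefficients $c_{ij}$: - Gourava1: $i+j+ij$; - Gourava2: $(i+j)ij$; - hGourava1: $(i+j+ij)^2$; - hGourava2: $((i+j)ij)^2$; - GouravaPC: $\sqrt{ij(i+j)}$; - InvSumDeg: $\frac{ij}{i+j}$; - rRandić: $\sqrt{ij}$; - Zagreb2: $ij$; - hZagreb1: $(i+j)^2$; - hZagreb2: $(ij)^2$. $F_3$ is the set of chemical graphs (of order $n$ and size $m$) with $(x_{12},x_{13},x_{22},x_{23},x_{33})$ equal to - $\left(0,\frac{3n-2m}{2},0,0,\frac{4m-3n}{2}\right)$ if $n$ is even; - $\left(1,\frac{3n-2m-3}{2},0,1,\frac{4m-3n-1}{2}\right)$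 if $n$ is odd. $F_4$ is the set of chemical graphs (of order $n$ and size $m$) with $(x_{12},x_{13},x_{22},x_{23},x_{33})$ equal to - $(2,0,m-2,0,0)$ if $m=n-1$; - $(0,0,6n-5m,6m-6n,0)$ if $n\le m<\frac{6n}{5}$; - $(0,0,0,6n-4m,5m-6n)$ if $\frac{6n}{5}\le m\le\frac{3n-3}{2}$. *)

theory Defs
  imports Complex_Main
begin

text \<open>
  A graph is a pair of a vertex set and a set of edges, an edge being the two-element set of its
  endpoints. The vertex type is arbitrary.
\<close>

type_synonym 'a graph = "'a set \<times> 'a set set"

abbreviation verts :: "'a graph \<Rightarrow> 'a set" where
  "verts G \<equiv> fst G"

abbreviation edges :: "'a graph \<Rightarrow> 'a set set" where
  "edges G \<equiv> snd G"

definition simple_graph :: "'a graph \<Rightarrow> bool" where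
  "simple_graph G \<longleftrightarrow> finite (verts G) \<and> (\<forall>e\<in>edges G. e \<subseteq> verts G \<and> card e = 2)"

definition graph_order :: "'a graph \<Rightarrow> nat" where
  "graph_order G = card (verts G)"

definition graph_size :: "'a graph \<Rightarrow> nat" where
  "graph_size G = card (edges G)"

definition deg :: "'a graph \<Rightarrow> 'a \<Rightarrow> nat" where
  "deg G v = card {e \<in> edges G. v \<in> e}"

definition connected_graph :: "'a graph \<Rightarrow> bool" where
  "connected_graph G \<longleftrightarrow> verts G \<noteq> {} \<and>
     (\<forall>u\<in>verts G. \<forall>v\<in>verts G. (u, v) \<in> {(x, y). {x, y} \<in> edges G}\<^sup>*)"

definition chemical_graph :: "'a graph \<Rightarrow> bool" where
  "chemical_graph G \<longleftrightarrow> simple_graph G \<and> connected_graph G \<and>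
     graph_order G \<ge> 7 \<and>
     real (graph_size G) \<le> (3 * real (graph_order G) - 3) / 2 \<and>
     (\<forall>v\<in>verts G. deg G v \<le> 3)"

definition edge_count :: "'a graph \<Rightarrow> nat \<Rightarrow> nat \<Rightarrow> nat" where
  "edge_count G i j = card {e \<in> edges G. \<exists>u v. e = {u, v} \<and> deg G u = i \<and> deg G v = j}"

definition degree_index :: "(nat \<Rightarrow> nat \<Rightarrow> real) \<Rightarrow> 'a graph \<Rightarrow> real" where
  "degree_index c G =
     c 1 2 * real (edge_count G 1 2) + c 1 3 * real (edge_count G 1 3) +
     c 2 2 * real (edge_count G 2 2) + c 2 3 * real (edge_count G 2 3) +
     c 3 3 * real (edge_count G 3 3)"

text \<open>
  The competitors range over graphs on the same vertex type. This is no restriction: every graph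
  of the same order as \<open>G\<close> has an isomorphic copy on the vertex set of \<open>G\<close>.
\<close>

definition extremal_for :: "('a graph \<Rightarrow> real) \<Rightarrow> 'a graph \<Rightarrow> bool" where
  "extremal_for f G \<longleftrightarrow> chemical_graph G \<and>
     ((\<forall>H. chemical_graph H \<and> graph_order H = graph_order G \<and> graph_size H = graph_size G
           \<longrightarrow> f H \<le> f G) \<or>
      (\<forall>H. chemical_graph H \<and> graph_order H = graph_order G \<and> graph_size H = graph_size G
           \<longrightarrow> f G \<le> f H))"

datatype index_name =
    Gourava1 | Gourava2 | hGourava1 | hGourava2 | GouravaPC
  | InvSumDeg | rRandic | Zagreb2 | hZagreb1 | hZagreb2

fun index_coeff :: "index_name \<Rightarrow> nat \<Rightarrow> nat \<Rightarrow> real" where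
  "index_coeff Gourava1 i j = real (i + j + i * j)"
| "index_coeff Gourava2 i j = real ((i + j) * (i * j))"
| "index_coeff hGourava1 i j = real ((i + j + i * j) ^ 2)"
| "index_coeff hGourava2 i j = real (((i + j) * (i * j)) ^ 2)"
| "index_coeff GouravaPC i j = sqrt (real (i * j * (i + j)))"
| "index_coeff InvSumDeg i j = real (i * j) / real (i + j)"
| "index_coeff rRandic i j = sqrt (real (i * j))"
| "index_coeff Zagreb2 i j = real (i * j)"
| "index_coeff hZagreb1 i j = real ((i + j) ^ 2)"
| "index_coeff hZagreb2 i j = real ((i * j) ^ 2)"

text \<open>
  The edge counts are taken as reals, so that the subtractions and halves in the descriptions of
  \<open>F3\<close> and \<open>F4\<close> are exact.
\<close>

definition edge_profile :: "'a graph \<Rightarrow> real \<times> real \<times> real \<times> real \<times> real" where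
  "edge_profile G =
     (real (edge_count G 1 2), real (edge_count G 1 3), real (edge_count G 2 2),
      real (edge_count G 2 3), real (edge_count G 3 3))"

definition F3 :: "'a graph set" where
  "F3 = {G. chemical_graph G \<and>
     (let n = real (graph_order G); m = real (graph_size G) in
        (even (graph_order G) \<and>
           edge_profile G = (0, (3 * n - 2 * m) / 2, 0, 0, (4 * m - 3 * n) / 2)) \<or>
        (odd (graph_order G) \<and>
           edge_profile G = (1, (3 * n - 2 * m - 3) / 2, 0, 1, (4 * m - 3 * n - 1) / 2)))}"

definition F4 :: "'a graph set" where
  "F4 = {G. chemical_graph G \<and>
     (let n = real (graph_order G); m = real (graph_size G) in
        (m = n - 1 \<and> edge_profile G = (2, 0, m - 2, 0, 0)) \<or>
        (n \<le> m \<and> m < 6 * n / 5 \<and>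
           edge_profile G = (0, 0, 6 * n - 5 * m, 6 * m - 6 * n, 0)) \<or>
        (6 * n / 5 \<le> m \<and> m \<le> (3 * n - 3) / 2 \<and>
           edge_profile G = (0, 0, 0, 6 * n - 4 * m, 5 * m - 6 * n)))}"

end

theory Submission
  imports Defs
begin

text \<open>
  For each of the ten indices, \<open>F3\<close> is the set of maximizers and \<open>F4\<close> the set of minimizers.

  Counting the edges, and counting the vertices by letting each vertex distribute a unit weight among
  its edges, gives two linear equations between the five edge counts and the order and size
  (\<open>subcubic_size_eq\<close>, \<open>subcubic_order_eq\<close>). Eliminating two of the counts turns the index into a
  constant plus a linear form in the other three. If all three coefficients have the right sign, the
  optimum is attained exactly where these three counts vanish, and the equations determine the
  remaining two.

  For the minimum, the counts to eliminate depend on the range of \<open>m\<close> (\<open>profile4_minimal\<close>). All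
  coefficients are positive, with one exception: in trees the coefficient of the (1,3)-edges may be
  slightly negative. This is repaired by \<open>edges_13_le\<close>, which holds because no vertex of degree 3 has
  three leaf neighbours. For the maximum, the (1,3)- and (3,3)-edges are eliminated
  (\<open>profile3_maximal\<close>). Now the coefficient of the (1,2)-edges may have the wrong sign, and
  \<open>edges_12_le\<close> helps: every (1,2)-edge is followed by a (2,2)- or (2,3)-edge of its own. If the order
  is odd, the three counts cannot all vanish, because the equations fix a combination of them modulo
  4; the best deviation is then one (1,2)-edge with one (2,3)-edge. What is needed of the ten indices
  is a finite list of inequalities between their coefficients (\<open>index_coeff_conditions\<close>).

  An optimal profile identifies the extremal graphs only if it is realized by some graph of the given
  order and size. For \<open>F4\<close>, take a path, or subdivide edges of a cubic graph: first the (3,3)-edges,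
  which gives independent vertices of degree 2 (\<open>dense_core_exists\<close>), and when these edges are used
  up, any edges, which keeps the vertices of degree 3 independent (\<open>sparse_core_exists\<close>). With as
  many edges as vertices, or one more, a triangle or the complete graph on 4 vertices without an edge
  replaces the cubic graph. For \<open>F3\<close>, hang a
  leaf on each vertex of degree 2 of such a graph (\<open>leaf_cubic_exists\<close>), and for odd order hang one
  more leaf on a leaf.
\<close>

section \<open>Connected simple graphs\<close>

lemma simple_edgeE:
  assumes "simple_graph G" "e \<in> edges G"
  obtains u v where "e = {u, v}" "u \<noteq> v" "u \<in> verts G" "v \<in> verts G"
proof -
  have "card e = 2" "e \<subseteq> verts G" using assms by (auto simp: simple_graph_def)
  then show thesis using that by (auto simp: card_2_iff)
qed

lemma simple_edgeD:
  assumes "simple_graph G" "{u, v} \<in> edges G"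
  shows "u \<noteq> v" "u \<in> verts G" "v \<in> verts G"
  using assms by (force simp: simple_graph_def)+

lemma finite_edges:
  assumes "simple_graph G" shows "finite (edges G)"
proof (rule finite_subset)
  show "edges G \<subseteq> Pow (verts G)" using assms by (auto simp: simple_graph_def)
  show "finite (Pow (verts G))" using assms by (auto simp: simple_graph_def)
qed

lemma connected_crossing_edge:
  assumes "simple_graph G" "connected_graph G" "S \<noteq> {}" "S \<subset> verts G"
  obtains u v where "u \<in> S" "v \<in> verts G - S" "{u, v} \<in> edges G"
proof (rule ccontr)
  assume neg: "\<not> thesis"
  have none: "{u, v} \<notin> edges G" if "u \<in> S" "v \<in> verts G" "v \<notin> S" for u v
    using neg \<open>\<And>u v. u \<in> S \<Longrightarrow> v \<in> verts G - S \<Longrightarrow> {u, v} \<in> edges G \<Longrightarrow> thesis\<close> that by auto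
  obtain s t where st: "s \<in> S" "t \<in> verts G" "t \<notin> S" using assms by blast
  then have "(s, t) \<in> {(x, y). {x, y} \<in> edges G}\<^sup>*"
    using assms by (auto simp: connected_graph_def)
  then have "t \<in> S"
  proof induction
    case base show ?case using st by simp
  next
    case (step y z)
    then have "{y, z} \<in> edges G" by simp
    then show ?case using none[of y z] step simple_edgeD(3)[OF assms(1)] by metis
  qed
  with st show False by simp
qed

text \<open>
  Grow a vertex set one vertex at a time along crossing edges: every new vertex brings a new inner
  edge.
\<close>

lemma connected_size_ge:
  assumes "simple_graph G" "connected_graph G"
  shows "graph_order G \<le> graph_size G + 1"
proof -
  have fin: "finite (verts G)" using assms by (auto simp: simple_graph_def)
  have "\<exists>S \<subseteq> verts G. card S = k \<and> k \<le> card {e \<in> edges G. e \<subseteq> S} + 1"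
    if "1 \<le> k" "k \<le> card (verts G)" for k
    using that
  proof (induction k rule: dec_induct)
    case base
    obtain s where "s \<in> verts G" using assms(2) by (auto simp: connected_graph_def)
    then show ?case by (intro exI[of _ "{s}"]) auto
  next
    case (step k)
    then obtain S where S: "S \<subseteq> verts G" "card S = k" "k \<le> card {e \<in> edges G. e \<subseteq> S} + 1"
      by auto
    have "S \<noteq> {}" "S \<subset> verts G" using S step by auto
    then obtain u v where uv: "u \<in> S" "v \<in> verts G - S" "{u, v} \<in> edges G"
      using connected_crossing_edge[OF assms] by metis
    have "insert {u, v} {e \<in> edges G. e \<subseteq> S} \<subseteq> {e \<in> edges G. e \<subseteq> insert v S}"
      using uv by auto
    then have "card (insert {u, v} {e \<in> edges G. e \<subseteq> S}) \<le> card {e \<in> edges G. e \<subseteq> insert v S}"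
      using finite_edges[OF assms(1)] by (intro card_mono) auto
    moreover have "card (insert {u, v} {e \<in> edges G. e \<subseteq> S}) = Suc (card {e \<in> edges G. e \<subseteq> S})"
      using uv finite_edges[OF assms(1)] by (subst card_insert_disjoint) auto
    moreover have "card (insert v S) = Suc k"
      using S uv fin by (metis DiffD2 card_insert_disjoint finite_subset)
    ultimately show ?case using S uv by (intro exI[of _ "insert v S"]) auto
  qed
  from this[of "card (verts G)"] assms fin obtain S where
    S: "S \<subseteq> verts G" "card S = card (verts G)" "card (verts G) \<le> card {e \<in> edges G. e \<subseteq> S} + 1"
    by (auto simp: connected_graph_def Suc_le_eq card_gt_0_iff)
  have "card {e \<in> edges G. e \<subseteq> S} \<le> card (edges G)"
    using finite_edges[OF assms(1)] by (intro card_mono) auto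
  with S show ?thesis by (simp add: graph_order_def graph_size_def)
qed

text \<open>
  Double counting of the incidences. The weight \<open>1\<close> gives the handshake lemma, the weight
  \<open>1 / deg G v\<close> counts the vertices by edges, and the indicator of degree 3 counts the ends of
  edges at vertices of degree 3.
\<close>

lemma weighted_degree_sum:
  fixes w :: "'a \<Rightarrow> real"
  assumes "simple_graph G"
  shows "(\<Sum>v\<in>verts G. w v * real (deg G v)) = (\<Sum>e\<in>edges G. \<Sum>v\<in>e. w v)"
proof -
  have fin: "finite (verts G)" using assms by (auto simp: simple_graph_def)
  have "(\<Sum>v\<in>verts G. w v * real (deg G v)) = (\<Sum>v\<in>verts G. \<Sum>e\<in>{e \<in> edges G. v \<in> e}. w v)"
    by (simp add: deg_def mult.commute)
  also have "\<dots> = (\<Sum>e\<in>edges G. \<Sum>v\<in>{v \<in> verts G. v \<in> e}. w v)"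
    using fin finite_edges[OF assms] by (rule sum.swap_restrict)
  also have "\<dots> = (\<Sum>e\<in>edges G. \<Sum>v\<in>e. w v)"
    using assms by (intro sum.cong) (auto simp: simple_graph_def)
  finally show ?thesis .
qed

lemma handshake:
  assumes "simple_graph G"
  shows "(\<Sum>v\<in>verts G. deg G v) = 2 * graph_size G"
proof -
  have "real (\<Sum>v\<in>verts G. deg G v) = (\<Sum>e\<in>edges G. \<Sum>v\<in>e. 1)"
    using weighted_degree_sum[OF assms, of "\<lambda>_. 1"] by simp
  also have "\<dots> = (\<Sum>e\<in>edges G. 2)"
    using assms by (intro sum.cong) (auto simp: simple_graph_def)
  also have "\<dots> = real (2 * graph_size G)" by (simp add: graph_size_def)
  finally show ?thesis by (simp only: of_nat_eq_iff)
qed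

text \<open>
  Used with a bound 2 to find an end of a path, and with a bound 3 to find a leaf when all degrees
  are 1 or 3.
\<close>

lemma exists_small_degree:
  assumes "simple_graph G" "2 * graph_size G < d * graph_order G"
  obtains v where "v \<in> verts G" "deg G v < d"
proof (rule ccontr)
  assume "\<not> thesis"
  then have "(\<Sum>v\<in>verts G. d) \<le> (\<Sum>v\<in>verts G. deg G v)"
    using that by (intro sum_mono) force
  then show False using handshake[OF assms(1)] assms(2)
    by (simp add: graph_order_def mult.commute)
qed

section \<open>Edge counts of subcubic graphs\<close>

text \<open>
  Chemical graphs without the bound on the size and with a weaker bound on the order: the equations
  below are also applied to the smaller graphs from which the extremal ones are built. Order 3 is
  what excludes an edge between two leaves, so that the five edge types are exhaustive.
\<close>

definition subcubic :: "'a graph \<Rightarrow> bool" where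
  "subcubic G \<longleftrightarrow> simple_graph G \<and> connected_graph G \<and> graph_order G \<ge> 3 \<and>
     (\<forall>v\<in>verts G. deg G v \<le> 3)"

definition typed_edges :: "'a graph \<Rightarrow> nat \<Rightarrow> nat \<Rightarrow> 'a set set" where
  "typed_edges G i j = {e \<in> edges G. \<exists>u v. e = {u, v} \<and> deg G u = i \<and> deg G v = j}"

lemma edge_count_card: "edge_count G i j = card (typed_edges G i j)"
  by (simp add: edge_count_def typed_edges_def)

lemma card_deg_eq: "card {e \<in> edges G. v \<in> e} = deg G v"
  by (simp add: deg_def)

text \<open>
  Contrapositive of the existence of a crossing edge: a set of vertices that no edge leaves is everything. All
  the small exceptional components below are excluded in this way.
\<close>

lemma connected_cover:
  assumes "simple_graph G" "connected_graph G" "S \<noteq> {}" "S \<subseteq> verts G"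
    and "\<And>u v. u \<in> S \<Longrightarrow> {u, v} \<in> edges G \<Longrightarrow> v \<in> S"
  shows "verts G = S"
proof (rule ccontr)
  assume "verts G \<noteq> S"
  then have "S \<subset> verts G" using assms(4) by auto
  then obtain u v where "u \<in> S" "v \<in> verts G - S" "{u, v} \<in> edges G"
    using connected_crossing_edge[OF assms(1-3)] by metis
  then show False using assms(5)[of u v] by simp
qed

lemma deg_pos:
  assumes "simple_graph G" "connected_graph G" "graph_order G \<ge> 2" "v \<in> verts G"
  shows "deg G v \<ge> 1"
proof (rule ccontr)
  assume "\<not> ?thesis"
  then have "{e \<in> edges G. v \<in> e} = {}"
    using finite_edges[OF assms(1)] by (simp add: deg_def not_le)
  then have "verts G = {v}"
    using assms by (intro connected_cover) blast+
  then show False using assms by (simp add: graph_order_def)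
qed

lemma incident_subset:
  assumes "simple_graph G" "F \<subseteq> {e \<in> edges G. v \<in> e}" "card F = deg G v"
  shows "{e \<in> edges G. v \<in> e} = F"
proof (rule card_subset_eq[symmetric])
  show "finite {e \<in> edges G. v \<in> e}" using finite_edges[OF assms(1)] by simp
  show "card F = card {e \<in> edges G. v \<in> e}" using assms(3) by (simp add: deg_def)
qed (rule assms(2))

lemma no_leaf_leaf_edge:
  assumes "simple_graph G" "connected_graph G" "graph_order G \<ge> 3"
    and "{u, v} \<in> edges G" "deg G u = 1"
  shows "deg G v \<noteq> 1"
proof
  assume v: "deg G v = 1"
  have 1: "{e \<in> edges G. u \<in> e} = {{u, v}}" "{e \<in> edges G. v \<in> e} = {{u, v}}"
    using assms v by (intro incident_subset; simp)+
  have "verts G = {u, v}"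
  proof (rule connected_cover[OF assms(1,2)])
    show "{u, v} \<subseteq> verts G" using simple_edgeD[OF assms(1,4)] by simp
    show "q \<in> {u, v}" if "p \<in> {u, v}" "{p, q} \<in> edges G" for p q
    proof -
      have "{p, q} \<in> {e \<in> edges G. u \<in> e} \<union> {e \<in> edges G. v \<in> e}" using that by auto
      then have "{p, q} = {u, v}" unfolding 1 by simp
      then show ?thesis by (auto simp: doubleton_eq_iff)
    qed
  qed simp
  then have "graph_order G \<le> 2"
    by (simp add: graph_order_def card_insert_if)
  then show False using assms by simp
qed

lemma typed_edges_disjoint:
  assumes "i \<le> j" "k \<le> l" "(i, j) \<noteq> (k, l)"
  shows "typed_edges G i j \<inter> typed_edges G k l = {}"
  using assms by (auto simp: typed_edges_def doubleton_eq_iff)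

lemma subcubic_edge_types:
  assumes "subcubic G"
  shows "edges G = typed_edges G 1 2 \<union> typed_edges G 1 3 \<union> typed_edges G 2 2 \<union>
           typed_edges G 2 3 \<union> typed_edges G 3 3" (is "_ = ?R")
proof
  show "?R \<subseteq> edges G" by (auto simp: typed_edges_def)
  show "edges G \<subseteq> ?R"
  proof
    fix e assume e: "e \<in> edges G"
    have G: "simple_graph G" "connected_graph G" "graph_order G \<ge> 3"
      using assms by (auto simp: subcubic_def)
    obtain u v where uv: "e = {u, v}" "u \<in> verts G" "v \<in> verts G"
      using simple_edgeE[OF G(1) e] by metis
    have "deg G w = 1 \<or> deg G w = 2 \<or> deg G w = 3" if "w \<in> verts G" for w
      using deg_pos[OF G(1,2) _ that] G(3) that assms unfolding subcubic_def by force
    then have "deg G u \<in> {1,2,3}" "deg G v \<in> {1,2,3}" using uv by auto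
    moreover have "\<not> (deg G u = 1 \<and> deg G v = 1)"
      using no_leaf_leaf_edge[OF G] e uv by blast
    moreover have "e = {v, u}" using uv by auto
    ultimately show "e \<in> ?R" using e uv unfolding typed_edges_def by blast
  qed
qed

lemma sum_over_edge_types:
  fixes h :: "'a set \<Rightarrow> real"
  assumes "subcubic G"
    and h: "\<And>u v. {u, v} \<in> edges G \<Longrightarrow> u \<noteq> v \<Longrightarrow> h {u, v} = k (deg G u) (deg G v)"
  shows "sum h (edges G) = k 1 2 * edge_count G 1 2 + k 1 3 * edge_count G 1 3 +
     k 2 2 * edge_count G 2 2 + k 2 3 * edge_count G 2 3 + k 3 3 * edge_count G 3 3"
proof -
  have G: "simple_graph G" using assms by (simp add: subcubic_def)
  have fin: "finite (typed_edges G i j)" for i j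
    using finite_edges[OF G] by (simp add: typed_edges_def)
  have part: "sum h (typed_edges G i j) = k i j * edge_count G i j" for i j
  proof -
    have "h e = k i j" if e: "e \<in> typed_edges G i j" for e
    proof -
      obtain u v where uv: "e = {u, v}" "deg G u = i" "deg G v = j" "{u, v} \<in> edges G"
        using e by (auto simp: typed_edges_def)
      then show ?thesis using h[of u v] simple_edgeD[OF G] by metis
    qed
    then show ?thesis by (simp add: edge_count_card)
  qed
  show ?thesis
    unfolding subcubic_edge_types[OF assms(1)]
    by (subst sum.union_disjoint;
        (simp add: fin part Int_Un_distrib2 typed_edges_disjoint)?)+
qed

lemma subcubic_size_eq:
  assumes "subcubic G"
  shows "edge_count G 1 2 + edge_count G 1 3 + edge_count G 2 2 + edge_count G 2 3
           + edge_count G 3 3 = graph_size G"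
proof -
  have "real (graph_size G) = (\<Sum>e\<in>edges G. 1)" by (simp add: graph_size_def)
  also have "\<dots> = real (edge_count G 1 2 + edge_count G 1 3 + edge_count G 2 2
      + edge_count G 2 3 + edge_count G 3 3)"
    by (subst sum_over_edge_types[OF assms, where k = "\<lambda>_ _. 1"]) auto
  finally show ?thesis by (simp only: of_nat_eq_iff)
qed

text \<open>
  Each vertex distributes the weight 1 equally among its incident edges; an edge with end degrees
  \<open>i\<close> and \<open>j\<close> then receives \<open>1/i + 1/j\<close>. The equation is multiplied by 6 to stay in the naturals.
\<close>

lemma subcubic_order_eq:
  assumes "subcubic G"
  shows "9 * edge_count G 1 2 + 8 * edge_count G 1 3 + 6 * edge_count G 2 2
           + 5 * edge_count G 2 3 + 4 * edge_count G 3 3 = 6 * graph_order G"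
proof -
  have G: "simple_graph G" "connected_graph G" "graph_order G \<ge> 3"
    using assms by (auto simp: subcubic_def)
  have "real (graph_order G) = (\<Sum>v\<in>verts G. 1 / real (deg G v) * real (deg G v))"
    unfolding graph_order_def card_eq_sum of_nat_sum
    using deg_pos[OF G(1,2)] G(3) by (intro sum.cong) force+
  also have "\<dots> = (\<Sum>e\<in>edges G. \<Sum>v\<in>e. 1 / real (deg G v))"
    by (rule weighted_degree_sum[OF G(1)])
  also have "\<dots> = (1/1 + 1/2) * edge_count G 1 2 + (1/1 + 1/3) * edge_count G 1 3
      + (1/2 + 1/2) * edge_count G 2 2 + (1/2 + 1/3) * edge_count G 2 3
      + (1/3 + 1/3) * edge_count G 3 3"
    by (subst sum_over_edge_types[OF assms, where k = "\<lambda>i j. 1 / real i + 1 / real j"]) auto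
  finally have "6 * real (graph_order G) = real (9 * edge_count G 1 2 + 8 * edge_count G 1 3
      + 6 * edge_count G 2 2 + 5 * edge_count G 2 3 + 4 * edge_count G 3 3)"
    by simp
  then show ?thesis by linarith
qed

lemma cubic_vertices_eq:
  assumes "subcubic G"
  shows "edge_count G 1 3 + edge_count G 2 3 + 2 * edge_count G 3 3
           = 3 * card {v \<in> verts G. deg G v = 3}"
proof -
  have G: "simple_graph G" "finite (verts G)"
    using assms by (auto simp: subcubic_def simple_graph_def)
  have "real (3 * card {v \<in> verts G. deg G v = 3})
      = (\<Sum>v\<in>verts G. of_bool (deg G v = 3) * real (deg G v))"
    using G(2) by (simp add: of_bool_def if_distrib[where f = "\<lambda>x. x * _"] sum.If_cases
        Int_def cong: if_cong)
  also have "\<dots> = (\<Sum>e\<in>edges G. \<Sum>v\<in>e. of_bool (deg G v = 3))"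
    by (rule weighted_degree_sum[OF G(1)])
  also have "\<dots> = real (edge_count G 1 3 + edge_count G 2 3 + 2 * edge_count G 3 3)"
    by (subst sum_over_edge_types[OF assms, where
          k = "\<lambda>i j. of_bool (i = 3) + of_bool (j = 3)"]) auto
  finally show ?thesis by (simp only: of_nat_eq_iff)
qed

text \<open>
  Send a pendant edge with other end \<open>v\<close> of degree 2 to the second edge at \<open>v\<close>. That edge is not
  itself of type (1,2), or the graph would be a path with 3 vertices. Two pendant edges with the same
  image would make the graph a path with 4 vertices, so the map is injective.
\<close>

lemma edges_12_le:
  assumes "subcubic G" "graph_order G \<ge> 5"
  shows "edge_count G 1 2 \<le> edge_count G 2 2 + edge_count G 2 3"
proof -
  have G: "simple_graph G" "connected_graph G" "graph_order G \<ge> 3"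
    using assms by (auto simp: subcubic_def)
  note fE = finite_edges[OF G(1)]
  let ?B = "typed_edges G 2 2 \<union> typed_edges G 2 3"
  let ?r = "\<lambda>e f. e \<noteq> f \<and> (\<exists>v. v \<in> e \<and> v \<in> f \<and> deg G v = 2)"
  have ends: "\<exists>u v. e = {u, v} \<and> u \<noteq> v \<and> deg G u = 1 \<and> deg G v = 2"
    if e: "e \<in> typed_edges G 1 2" for e
  proof -
    obtain u v where "e = {u, v}" "deg G u = 1" "deg G v = 2"
      using e by (auto simp: typed_edges_def)
    then show ?thesis by (intro exI[of _ u] exI[of _ v]) auto
  qed
  have inc1: "{g \<in> edges G. u \<in> g} = {e}" if "e \<in> edges G" "u \<in> e" "deg G u = 1" for e u
    using that by (intro incident_subset[OF G(1)]) auto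
  have inc2: "{g \<in> edges G. v \<in> g} = {e, f}"
    if "e \<in> edges G" "f \<in> edges G" "e \<noteq> f" "v \<in> e" "v \<in> f" "deg G v = 2" for e f v
    using that by (intro incident_subset[OF G(1)]) auto
  have "card (typed_edges G 1 2) \<le> card ?B"
  proof (rule card_le_if_inj_on_rel[where r = ?r])
    show "finite ?B" using fE by (simp add: typed_edges_def)
  next
    fix e assume e: "e \<in> typed_edges G 1 2"
    then obtain u v where uv: "e = {u, v}" "u \<noteq> v" "deg G u = 1" "deg G v = 2"
      using ends by blast
    have eE: "e \<in> edges G" using e by (simp add: typed_edges_def)
    have iu: "{g \<in> edges G. u \<in> g} = {e}" using inc1[OF eE] uv by simp
    have "card {e \<in> edges G. v \<in> e} = 2" using uv by (simp add: deg_def)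
    then obtain f where f: "f \<in> edges G" "v \<in> f" "f \<noteq> e"
      using eE uv(1) unfolding card_2_iff by blast
    obtain w where w: "f = {v, w}" "v \<noteq> w" "w \<in> verts G"
      using simple_edgeE[OF G(1) f(1)] f(2) by (metis insert_commute insert_iff singletonD)
    have "deg G w \<noteq> 1"
    proof
      assume w1: "deg G w = 1"
      have iw: "{e \<in> edges G. w \<in> e} = {f}"
        using w w1 f by (intro incident_subset[OF G(1)]) auto
      have iv: "{e \<in> edges G. v \<in> e} = {e, f}" using inc2[OF eE f(1)] f uv by auto
      have "verts G = {u, v, w}"
      proof (rule connected_cover[OF G(1,2)])
        show "{u, v, w} \<subseteq> verts G"
          using simple_edgeD[OF G(1)] eE f(1) uv(1) w(1) by blast
        show "q \<in> {u, v, w}" if "p \<in> {u, v, w}" "{p, q} \<in> edges G" for p q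
        proof -
          have "{p, q} \<in> {e \<in> edges G. u \<in> e} \<union> {e \<in> edges G. v \<in> e} \<union> {e \<in> edges G. w \<in> e}"
            using that by auto
          then have "{p, q} = e \<or> {p, q} = f" unfolding iu iw iv by auto
          then show ?thesis using uv(1) w(1) by (auto simp: doubleton_eq_iff)
        qed
      qed simp
      then have "graph_order G \<le> 3" by (simp add: graph_order_def card_insert_if)
      then show False using assms by simp
    qed
    moreover have "deg G w \<ge> 1" "deg G w \<le> 3"
      using deg_pos[OF G(1,2)] G(3) w(3) assms(1) by (auto simp: subcubic_def)
    ultimately have "deg G w = 2 \<or> deg G w = 3" by linarith
    then have "f \<in> ?B" using f(1) w(1) uv(4) by (auto simp: typed_edges_def)
    then show "\<exists>f. f \<in> ?B \<and> ?r e f" using f uv by blast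
  next
    fix e1 e2 f
    assume e: "e1 \<in> typed_edges G 1 2" "e2 \<in> typed_edges G 1 2" and f: "f \<in> ?B"
      and r: "?r e1 f" "?r e2 f"
    obtain u1 v1 where 1: "e1 = {u1, v1}" "u1 \<noteq> v1" "deg G u1 = 1" "deg G v1 = 2"
      using ends[OF e(1)] by blast
    obtain u2 v2 where 2: "e2 = {u2, v2}" "u2 \<noteq> v2" "deg G u2 = 1" "deg G v2 = 2"
      using ends[OF e(2)] by blast
    have v: "v1 \<in> f" "v2 \<in> f" using r 1 2 by auto
    have E: "e1 \<in> edges G" "e2 \<in> edges G" "f \<in> edges G"
      using e f by (auto simp: typed_edges_def)
    have j1: "{e \<in> edges G. u1 \<in> e} = {e1}" using inc1[OF E(1)] 1 by simp
    have j2: "{e \<in> edges G. u2 \<in> e} = {e2}" using inc1[OF E(2)] 2 by simp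
    have i1: "{e \<in> edges G. v1 \<in> e} = {e1, f}" using inc2[OF E(1,3)] r v 1 by auto
    have i2: "{e \<in> edges G. v2 \<in> e} = {e2, f}" using inc2[OF E(2,3)] r v 2 by auto
    show "e1 = e2"
    proof (cases "v1 = v2")
      case True
      then have "{e1, f} = {e2, f}" using i1 i2 by simp
      then show ?thesis using r by (auto simp: doubleton_eq_iff)
    next
      case False
      obtain p q where "f = {p, q}" using simple_edgeE[OF G(1) E(3)] by metis
      then have f': "f = {v1, v2}" using v False by auto
      have "verts G = {u1, v1, v2, u2}"
      proof (rule connected_cover[OF G(1,2)])
        show "{u1, v1, v2, u2} \<subseteq> verts G"
          using simple_edgeD[OF G(1)] E 1(1) 2(1) by blast
        show "q \<in> {u1, v1, v2, u2}" if "p \<in> {u1, v1, v2, u2}" "{p, q} \<in> edges G" for p q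
        proof -
          have "{p, q} \<in> {e \<in> edges G. u1 \<in> e} \<union> {e \<in> edges G. v1 \<in> e} \<union>
              {e \<in> edges G. v2 \<in> e} \<union> {e \<in> edges G. u2 \<in> e}"
            using that by auto
          then have "{p, q} = e1 \<or> {p, q} = e2 \<or> {p, q} = f"
            unfolding i1 i2 j1 j2 by auto
          then show ?thesis using 1(1) 2(1) f' by (auto simp: doubleton_eq_iff)
        qed
      qed simp
      then have "graph_order G \<le> 4" by (simp add: graph_order_def card_insert_if)
      then show ?thesis using assms by simp
    qed
  qed
  also have "\<dots> \<le> edge_count G 2 2 + edge_count G 2 3"
    by (simp add: edge_count_card card_Un_le)
  finally show ?thesis by (simp add: edge_count_card)
qed

text \<open>
  No vertex of degree 3 has three leaf neighbours, since otherwise the graph would be a star with 4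
  vertices. Hence there are at most \<open>2 * k\<close> edges of type (1,3), where \<open>k\<close> is the number of vertices
  of degree 3, and counting the edge ends at these vertices expresses \<open>3 * k\<close> by the edge counts.
\<close>

lemma edges_13_le:
  assumes "subcubic G" "graph_order G \<ge> 5"
  shows "edge_count G 1 3 \<le> 2 * edge_count G 2 3 + 4 * edge_count G 3 3"
proof -
  have G: "simple_graph G" "connected_graph G" "graph_order G \<ge> 3"
    using assms by (auto simp: subcubic_def)
  note fE = finite_edges[OF G(1)]
  have fV: "finite (verts G)" using G(1) by (simp add: simple_graph_def)
  let ?V3 = "{v \<in> verts G. deg G v = 3}"
  let ?L = "\<lambda>v. {e \<in> typed_edges G 1 3. v \<in> e}"
  have "typed_edges G 1 3 \<subseteq> (\<Union>v\<in>?V3. ?L v)"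
    using simple_edgeD[OF G(1)] by (fastforce simp: typed_edges_def)
  then have "card (typed_edges G 1 3) \<le> card (\<Union>v\<in>?V3. ?L v)"
    using fE fV by (intro card_mono) (auto simp: typed_edges_def)
  also have "\<dots> \<le> (\<Sum>v\<in>?V3. card (?L v))"
    using fV by (intro card_UN_le) simp
  also have "\<dots> \<le> (\<Sum>v\<in>?V3. 2)"
  proof (rule sum_mono)
    fix v assume v: "v \<in> ?V3"
    have sub: "?L v \<subseteq> {e \<in> edges G. v \<in> e}" by (auto simp: typed_edges_def)
    show "card (?L v) \<le> 2"
    proof (rule ccontr)
      assume "\<not> ?thesis"
      then have "3 \<le> card (?L v)" by simp
      moreover have "card (?L v) \<le> 3"
        using card_mono[OF _ sub] fE v by (simp add: card_deg_eq)
      ultimately have c3: "card (?L v) = 3" by simp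
      then have all: "{e \<in> edges G. v \<in> e} = ?L v"
        using v by (intro incident_subset[OF G(1) sub]) simp
      have leaf: "deg G w = 1" "{e \<in> edges G. w \<in> e} = {{v, w}}"
        if "{v, w} \<in> edges G" for w
      proof -
        have "{v, w} \<in> {e \<in> edges G. v \<in> e}" using that by simp
        then have "{v, w} \<in> typed_edges G 1 3" unfolding all by simp
        then show "deg G w = 1" using v by (auto simp: typed_edges_def doubleton_eq_iff)
        then show "{e \<in> edges G. w \<in> e} = {{v, w}}"
          using that by (intro incident_subset[OF G(1)]) auto
      qed
      let ?N = "{w. {v, w} \<in> edges G}"
      have "verts G = insert v ?N"
      proof (rule connected_cover[OF G(1,2)])
        show "insert v ?N \<subseteq> verts G" using v simple_edgeD[OF G(1)] by blast
        show "q \<in> insert v ?N" if "p \<in> insert v ?N" "{p, q} \<in> edges G" for p q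
        proof (cases "p = v")
          case True then show ?thesis using that by simp
        next
          case False
          then have "{v, p} \<in> edges G" using that by simp
          moreover have "{p, q} \<in> {e \<in> edges G. p \<in> e}" using that by simp
          ultimately have "{p, q} = {v, p}" using leaf(2)[of p] by simp
          then show ?thesis using False by (auto simp: doubleton_eq_iff)
        qed
      qed simp
      moreover have "card ?N \<le> 3"
      proof -
        have "card ?N = card ((\<lambda>w. {v, w}) ` ?N)"
          by (rule card_image[symmetric]) (auto simp: inj_on_def doubleton_eq_iff)
        also have "\<dots> \<le> card {e \<in> edges G. v \<in> e}" using fE by (intro card_mono) auto
        finally show ?thesis using v by (simp add: card_deg_eq)
      qed
      ultimately have "graph_order G \<le> 4"
        unfolding graph_order_def using card_insert_le_m1[of 4 ?N v] by simp
      then show False using assms by simp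
    qed
  qed
  finally have "edge_count G 1 3 \<le> 2 * card ?V3" by (simp add: edge_count_card)
  then show ?thesis using cubic_vertices_eq[OF assms(1)] by linarith
qed

section \<open>The linear programme for the edge counts\<close>

type_synonym profile = "real \<times> real \<times> real \<times> real \<times> real"

fun profile_value :: "(nat \<Rightarrow> nat \<Rightarrow> real) \<Rightarrow> profile \<Rightarrow> real" where
  "profile_value c (a, b, p, q, r) = c 1 2 * a + c 1 3 * b + c 2 2 * p + c 2 3 * q + c 3 3 * r"

text \<open>
  The index depends on the edge counts only, so its extremal values can be sought among the tuples
  that satisfy the two linear equations and the two inequalities for the edge counts.
\<close>

lemma degree_index_profile: "degree_index c G = profile_value c (edge_profile G)"
  by (simp add: degree_index_def edge_profile_def)

definition profile3 :: "nat \<Rightarrow> nat \<Rightarrow> profile" where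
  "profile3 n m =
     (if even n then (0, (3 * real n - 2 * real m) / 2, 0, 0, (4 * real m - 3 * real n) / 2)
      else (1, (3 * real n - 2 * real m - 3) / 2, 0, 1, (4 * real m - 3 * real n - 1) / 2))"

definition profile4 :: "nat \<Rightarrow> nat \<Rightarrow> profile" where
  "profile4 n m =
     (if n = m + 1 then (2, 0, real m - 2, 0, 0)
      else if 5 * m < 6 * n then (0, 0, 6 * real n - 5 * real m, 6 * real m - 6 * real n, 0)
      else (0, 0, 0, 6 * real n - 4 * real m, 5 * real m - 6 * real n))"

text \<open>
  Eliminating the counts of (1,3)- and (3,3)-edges by the two linear equations writes the index as a
  function of the order and size plus a linear form in the other three counts. The coefficients of
  this form are the excesses of the three edge types.
\<close>

definition excess_12 :: "(nat \<Rightarrow> nat \<Rightarrow> real) \<Rightarrow> real" where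
  "excess_12 c = c 1 2 - 5/4 * c 1 3 + 1/4 * c 3 3"

definition excess_22 :: "(nat \<Rightarrow> nat \<Rightarrow> real) \<Rightarrow> real" where
  "excess_22 c = c 2 2 - 1/2 * c 1 3 - 1/2 * c 3 3"

definition excess_23 :: "(nat \<Rightarrow> nat \<Rightarrow> real) \<Rightarrow> real" where
  "excess_23 c = c 2 3 - 1/4 * c 1 3 - 3/4 * c 3 3"

text \<open>
  The excess of the (1,2)-edges may be positive. Such edges are paid for by the (2,2)- and (2,3)-edges
  that accompany them, which is why sums of excesses occur. The last three conditions serve odd
  orders: there the least unavoidable deviation is one (1,2)-edge with one (2,3)-edge, and each
  condition rules out one family of rival deviations.
\<close>

definition rewards_13_33 :: "(nat \<Rightarrow> nat \<Rightarrow> real) \<Rightarrow> bool" where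
  "rewards_13_33 c \<longleftrightarrow>
     excess_22 c < 0 \<and> excess_23 c < 0 \<and>
     excess_12 c + excess_22 c < 0 \<and> excess_12 c + excess_23 c < 0 \<and>
     excess_23 c < excess_12 c \<and> excess_22 c < excess_12 c + excess_23 c \<and>
     2 * (excess_12 c + excess_22 c) < excess_12 c + excess_23 c"

text \<open>
  For trees, the counts of (1,2)- and (2,2)-edges are eliminated. The coefficient \<open>g13\<close> is negative for
  the inverse sum indegree index; the last two inequalities make up for this, because a (1,3)-edge
  forces a share of a (2,3)- or (3,3)-edge.
\<close>

definition penalizes_tree_branching :: "(nat \<Rightarrow> nat \<Rightarrow> real) \<Rightarrow> bool" where
  "penalizes_tree_branching c \<longleftrightarrow>
     (let g13 = c 1 3 - 1/3 * c 2 2 - 2/3 * c 1 2;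
          g23 = c 2 3 - 4/3 * c 2 2 + 1/3 * c 1 2;
          g33 = c 3 3 - 5/3 * c 2 2 + 2/3 * c 1 2
      in g23 > 0 \<and> g33 > 0 \<and> 2 * g13 + g23 > 0 \<and> 4 * g13 + g33 > 0)"

text \<open>
  For graphs with a cycle, the eliminated counts are those of the (2,2)- and (2,3)-edges when there are
  few edges, and those of the (2,3)- and (3,3)-edges otherwise. The third condition serves both
  eliminations: it is about the (3,3)-edges in the first and about the (2,2)-edges in the second.
\<close>

definition penalizes_leaves :: "(nat \<Rightarrow> nat \<Rightarrow> real) \<Rightarrow> bool" where
  "penalizes_leaves c \<longleftrightarrow>
     c 1 2 - 4 * c 2 2 + 3 * c 2 3 > 0 \<and> c 1 3 - 3 * c 2 2 + 2 * c 2 3 > 0 \<and>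
     c 2 2 - 2 * c 2 3 + c 3 3 > 0 \<and>
     c 1 2 - 5 * c 2 3 + 4 * c 3 3 > 0 \<and> c 1 3 - 4 * c 2 3 + 3 * c 3 3 > 0"

lemma sqrt_bounds:
  "1.414 < sqrt 2" "sqrt 2 < 1.415" "1.732 < sqrt 3" "sqrt 3 < 1.7321"
  "2.449 < sqrt 6" "sqrt 6 < 2.4495" "3.464 < sqrt 12" "sqrt 12 < 3.4642"
  "5.477 < sqrt 30" "sqrt 30 < 5.478" "7.348 < sqrt 54" "sqrt 54 < 7.349"
  by (rule real_less_rsqrt real_less_lsqrt; simp add: power2_eq_square)+

lemma index_coeff_conditions:
  "rewards_13_33 (index_coeff idx)" "penalizes_tree_branching (index_coeff idx)"
  "penalizes_leaves (index_coeff idx)"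
proof -
  have r: "sqrt 4 = 2" "sqrt 9 = 3" "sqrt 16 = 4" by (simp_all add: real_sqrt_unique)
  note defs = rewards_13_33_def penalizes_tree_branching_def penalizes_leaves_def
    excess_12_def excess_22_def excess_23_def Let_def
  show "rewards_13_33 (index_coeff idx)" "penalizes_tree_branching (index_coeff idx)"
    "penalizes_leaves (index_coeff idx)"
    using sqrt_bounds unfolding defs by (cases idx; simp add: r)+
qed

text \<open>
  Here \<open>s\<close>, \<open>t\<close>, \<open>u\<close> are the excesses of the (1,2)-, (2,2)- and (2,3)-edges, and \<open>a\<close>, \<open>c\<close>, \<open>d\<close> their
  numbers. The congruence is what remains of the two linear equations modulo 4 when the order is odd.
  It excludes \<open>a = c = d = 0\<close>, and also \<open>a = c = 1\<close>, \<open>d = 0\<close>, which would be a better deviation than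
  \<open>a = d = 1\<close>, \<open>c = 0\<close> for one of the indices.
\<close>

lemma bound_by_12_edges:
  fixes a c d :: nat and s t u :: real
  assumes "t < 0" "u < 0" "s + t < 0" "s + u < 0" "u < s" "t < s + u" "2 * (s + t) < s + u"
    and "a \<le> c + d"
  shows "s * a + t * c + u * d \<le> 0"
    and "s * a + t * c + u * d = 0 \<Longrightarrow> a = 0 \<and> c = 0 \<and> d = 0"
    and "4 dvd 5 * a + 2 * c + d + 2 \<Longrightarrow> s * a + t * c + u * d \<le> s + u"
    and "4 dvd 5 * a + 2 * c + d + 2 \<Longrightarrow> s * a + t * c + u * d = s + u \<Longrightarrow>
           a = 1 \<and> c = 0 \<and> d = 1"
proof -
  (* Only a positive excess of the (1,2)-edges has to be charged to the other two types. *)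
  define w where "w = max s 0"
  have sa: "s * a \<le> w * (c + d)"
  proof -
    have "s * a \<le> w * a" by (intro mult_right_mono) (auto simp: w_def)
    also have "\<dots> \<le> w * real (c + d)"
      using assms(8) by (intro mult_left_mono) (auto simp: w_def)
    finally show ?thesis by simp
  qed
  have neg: "w + t < 0" "w + u < 0" using assms by (auto simp: w_def)
  have ub: "s * a + t * c + u * d \<le> (w + t) * c + (w + u) * d"
    using sa by (simp add: algebra_simps)
  have lin: "(w + t) * c \<le> (w + t) * k" "(w + u) * c \<le> (w + u) * k" if "real c \<ge> k" for c k
    using neg that by (auto intro!: mult_left_mono_neg)
  show le: "s * a + t * c + u * d \<le> 0"
    using ub lin(1)[of 0 c] lin(2)[of 0 d] by simp
  show "a = 0 \<and> c = 0 \<and> d = 0" if z: "s * a + t * c + u * d = 0"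
  proof -
    have "c = 0"
    proof (rule ccontr)
      assume "c \<noteq> 0"
      then have "(w + t) * c \<le> w + t" using lin(1)[of 1 c] by simp
      moreover have "(w + u) * d \<le> 0" using lin(2)[of 0 d] by simp
      ultimately show False using ub z neg by linarith
    qed
    moreover have "d = 0"
    proof (rule ccontr)
      assume "d \<noteq> 0"
      then have "(w + u) * d \<le> w + u" using lin(2)[of 1 d] by simp
      moreover have "(w + t) * c \<le> 0" using lin(1)[of 0 c] by simp
      ultimately show False using ub z neg by linarith
    qed
    ultimately show ?thesis using assms(8) by simp
  qed
  have key: "a = 1 \<and> c = 0 \<and> d = 1 \<or> s * a + t * c + u * d < s + u"
    if dv: "4 dvd 5 * a + 2 * c + d + 2"
  proof -
    consider "c = 0" "d = 0" | "c = 0" "d = 1" | "c = 0" "d \<ge> 2" | "c \<ge> 1" "d \<ge> 1"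
      | "c = 1" "d = 0" | "c \<ge> 2" "d = 0" by linarith
    then show ?thesis
    proof cases
      case 1
      then have "4 dvd (2 :: nat)" using dv assms(8) by (simp add: numeral_2_eq_2)
      then show ?thesis by presburger
    next
      case 2
      then have "a \<noteq> 0" using dv by presburger
      then show ?thesis using 2 assms(8) by simp
    next
      case 3
      then have "(w + t) * c \<le> 0" "(w + u) * d \<le> 2 * (w + u)"
        using lin(1)[of 0 c] lin(2)[of 2 d] by (simp_all add: mult.commute[of 2])
      moreover have "2 * (w + u) < s + u" using assms by (simp add: w_def max_def)
      ultimately show ?thesis using ub by (intro disjI2) argo
    next
      case 4
      then have "(w + t) * c \<le> w + t" "(w + u) * d \<le> w + u"
        using lin(1)[of 1 c] lin(2)[of 1 d] by simp_all
      moreover have "(w + t) + (w + u) < s + u" using assms by (simp add: w_def max_def)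
      ultimately show ?thesis using ub by (intro disjI2) argo
    next
      case 5
      then have "a = 0 \<or> a = 1" using assms(8) by auto
      then show ?thesis using 5 dv assms by auto
    next
      case 6
      then have "(w + t) * c \<le> 2 * (w + t)" "(w + u) * d \<le> 0"
        using lin(1)[of 2 c] lin(2)[of 0 d] by (simp_all add: mult.commute[of 2])
      moreover have "2 * (w + t) < s + u" using assms by (simp add: w_def max_def)
      ultimately show ?thesis using ub by (intro disjI2) argo
    qed
  qed
  show "s * a + t * c + u * d \<le> s + u" if "4 dvd 5 * a + 2 * c + d + 2"
    using key[OF that] by auto
  show "a = 1 \<and> c = 0 \<and> d = 1" if "4 dvd 5 * a + 2 * c + d + 2" "s * a + t * c + u * d = s + u"
    using key[OF that(1)] that(2) by auto
qed

lemma profile3_maximal: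
  fixes a b p q r n m :: nat
  assumes "rewards_13_33 c"
    and m: "a + b + p + q + r = m" and n: "9 * a + 8 * b + 6 * p + 5 * q + 4 * r = 6 * n"
    and "a \<le> p + q"
  shows "profile_value c (a, b, p, q, r) \<le> profile_value c (profile3 n m)"
    and "profile_value c (a, b, p, q, r) = profile_value c (profile3 n m) \<Longrightarrow>
           (real a, real b, real p, real q, real r) = profile3 n m"
proof -
  have R: "real a + real b + real p + real q + real r = real m"
    "9 * real a + 8 * real b + 6 * real p + 5 * real q + 4 * real r = 6 * real n"
    using arg_cong[OF m, of real] arg_cong[OF n, of real] by simp_all
  have b: "real b = (3 * real n - 2 * real m) / 2 - 5/4 * a - 1/2 * p - 1/4 * q"
    and r: "real r = (4 * real m - 3 * real n) / 2 + 1/4 * a - 1/2 * p - 3/4 * q"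
    using R by (simp_all add: field_simps)
  let ?v = "excess_12 c * a + excess_22 c * p + excess_23 c * q"
  let ?base = "c 1 3 * ((3 * real n - 2 * real m) / 2) + c 3 3 * ((4 * real m - 3 * real n) / 2)"
  have v: "profile_value c (a, b, p, q, r) = ?v + ?base"
    by (simp add: b r excess_12_def excess_22_def excess_23_def field_simps)
  note bound = bound_by_12_edges[of "excess_22 c" "excess_23 c" "excess_12 c" a p q]
  note c = assms(1)[unfolded rewards_13_33_def]
  show "profile_value c (a, b, p, q, r) \<le> profile_value c (profile3 n m)"
    and "profile_value c (a, b, p, q, r) = profile_value c (profile3 n m) \<Longrightarrow>
           (real a, real b, real p, real q, real r) = profile3 n m"
  proof (atomize (full), cases "even n")
    case True
    have "profile_value c (profile3 n m) = ?base"
      using True by (simp add: profile3_def)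
    then show "profile_value c (a, b, p, q, r) \<le> profile_value c (profile3 n m) \<and>
      (profile_value c (a, b, p, q, r) = profile_value c (profile3 n m) \<longrightarrow>
           (real a, real b, real p, real q, real r) = profile3 n m)"
      using bound(1,2) c assms(4) True unfolding v by (auto simp: profile3_def b r)
  next
    case False
    then obtain k where k: "n = 2 * k + 1" by (auto elim: oddE)
    (* Six times the odd order is 2 modulo 4. *)
    have "(5 * a + 2 * p + q + 2) + 4 * (m + b) = 9 * a + 8 * b + 6 * p + 5 * q + 4 * r + 2"
      by (simp add: m[symmetric])
    also have "\<dots> = 4 * (3 * k + 2)" by (simp add: n k)
    finally have "(5 * a + 2 * p + q + 2) + 4 * (m + b) = 4 * (3 * k + 2)" .
    then have "4 dvd 5 * a + 2 * p + q + 2"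
      by (metis dvd_add_left_iff dvd_triv_left)
    moreover have "profile_value c (profile3 n m) = excess_12 c + excess_23 c + ?base"
      using False by (simp add: profile3_def excess_12_def excess_23_def field_simps)
    ultimately show "profile_value c (a, b, p, q, r) \<le> profile_value c (profile3 n m) \<and>
      (profile_value c (a, b, p, q, r) = profile_value c (profile3 n m) \<longrightarrow>
           (real a, real b, real p, real q, real r) = profile3 n m)"
      using bound(3,4) c assms(4) False unfolding v by (auto simp: profile3_def b r field_simps)
  qed
qed

lemma positive_combination:
  fixes x y z :: nat and s t u :: real
  assumes "s > 0" "t > 0" "u > 0"
  shows "s * x + t * y + u * z \<ge> 0"
    and "s * x + t * y + u * z = 0 \<Longrightarrow> x = 0 \<and> y = 0 \<and> z = 0"
proof -
  have "s * x \<ge> 0" "t * y \<ge> 0" "u * z \<ge> 0" using assms by simp_all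
  then show "s * x + t * y + u * z \<ge> 0"
    and "s * x + t * y + u * z = 0 \<Longrightarrow> x = 0 \<and> y = 0 \<and> z = 0"
    using assms by (auto simp: add_nonneg_eq_0_iff)
qed

lemma profile4_minimal:
  fixes a b p q r n m :: nat
  assumes "penalizes_tree_branching c" "penalizes_leaves c"
    and m: "a + b + p + q + r = m" and n: "9 * a + 8 * b + 6 * p + 5 * q + 4 * r = 6 * n"
    and "b \<le> 2 * q + 4 * r" "n \<le> m + 1"
  shows "profile_value c (profile4 n m) \<le> profile_value c (a, b, p, q, r)"
    and "profile_value c (profile4 n m) = profile_value c (a, b, p, q, r) \<Longrightarrow>
           (real a, real b, real p, real q, real r) = profile4 n m"
proof -
  have R: "real a + real b + real p + real q + real r = real m"
    "9 * real a + 8 * real b + 6 * real p + 5 * real q + 4 * real r = 6 * real n"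
    using arg_cong[OF m, of real] arg_cong[OF n, of real] by simp_all
  have "profile_value c (profile4 n m) \<le> profile_value c (a, b, p, q, r) \<and>
    (profile_value c (profile4 n m) = profile_value c (a, b, p, q, r) \<longrightarrow>
           (real a, real b, real p, real q, real r) = profile4 n m)"
  proof -
    consider "n = m + 1" | "n \<noteq> m + 1" "5 * m < 6 * n" | "n \<noteq> m + 1" "6 * n \<le> 5 * m" by linarith
    then show ?thesis
    proof cases
      case 1
      let ?g13 = "c 1 3 - 1/3 * c 2 2 - 2/3 * c 1 2"
      let ?g23 = "c 2 3 - 4/3 * c 2 2 + 1/3 * c 1 2"
      let ?g33 = "c 3 3 - 5/3 * c 2 2 + 2/3 * c 1 2"
      let ?v = "?g13 * b + ?g23 * q + ?g33 * r"
      have g: "?g23 > 0" "?g33 > 0" "2 * ?g13 + ?g23 > 0" "4 * ?g13 + ?g33 > 0"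
        using assms(1) by (simp_all add: penalizes_tree_branching_def Let_def)
      have a: "real a = 2 - 2/3 * b + 1/3 * q + 2/3 * r"
        and p: "real p = real m - 2 - 1/3 * b - 4/3 * q - 5/3 * r"
        using R 1 by (simp_all add: field_simps)
      have v: "profile_value c (a, b, p, q, r) = ?v + profile_value c (profile4 n m)"
        using 1 by (simp add: profile4_def a p field_simps)
      (* Only a negative coefficient has to be charged, by the bound on the (1,3)-edges. *)
      define w where "w = min ?g13 0"
      have w: "w + w + ?g23 > 0" "4 * w + ?g33 > 0" using g by (auto simp: w_def min_def)
      have "w * real (2 * q + 4 * r) \<le> w * b"
        using assms(5) by (intro mult_left_mono_neg) (auto simp: w_def)
      also have "\<dots> \<le> ?g13 * b" by (intro mult_right_mono) (auto simp: w_def)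
      finally have lb: "?v \<ge> (w + w + ?g23) * q + (4 * w + ?g33) * r"
        by (simp add: field_simps)
      note z = positive_combination[OF w zero_less_one, of q r 0]
      have "?v \<ge> 0" using lb z(1) by simp
      moreover have "b = 0 \<and> q = 0 \<and> r = 0" if "?v = 0"
        using lb z that assms(5) by simp
      ultimately show ?thesis unfolding v using 1 by (auto simp: profile4_def a p)
    next
      case 2
      let ?v = "(c 1 2 - 4 * c 2 2 + 3 * c 2 3) * a + (c 1 3 - 3 * c 2 2 + 2 * c 2 3) * b
        + (c 2 2 - 2 * c 2 3 + c 3 3) * r"
      have p: "real p = 6 * real n - 5 * real m - 4 * a - 3 * b + r"
        and q: "real q = 6 * real m - 6 * real n + 3 * a + 2 * b - 2 * r"
        using R by (simp_all add: field_simps)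
      have v: "profile_value c (a, b, p, q, r) = ?v + profile_value c (profile4 n m)"
        using 2 by (simp add: profile4_def p q field_simps)
      note z = positive_combination[of "c 1 2 - 4 * c 2 2 + 3 * c 2 3" "c 1 3 - 3 * c 2 2 + 2 * c 2 3"
          "c 2 2 - 2 * c 2 3 + c 3 3" a b r]
      have "?v \<ge> 0" "?v = 0 \<Longrightarrow> a = 0 \<and> b = 0 \<and> r = 0"
        using z assms(2) unfolding penalizes_leaves_def by blast+
      then show ?thesis unfolding v using 2 by (auto simp: profile4_def p q)
    next
      case 3
      let ?v = "(c 1 2 - 5 * c 2 3 + 4 * c 3 3) * a + (c 1 3 - 4 * c 2 3 + 3 * c 3 3) * b
        + (c 2 2 - 2 * c 2 3 + c 3 3) * p"
      have q: "real q = 6 * real n - 4 * real m - 5 * a - 4 * b - 2 * p"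
        and r: "real r = 5 * real m - 6 * real n + 4 * a + 3 * b + p"
        using R by (simp_all add: field_simps)
      have v: "profile_value c (a, b, p, q, r) = ?v + profile_value c (profile4 n m)"
        using 3 by (simp add: profile4_def q r field_simps)
      note z = positive_combination[of "c 1 2 - 5 * c 2 3 + 4 * c 3 3" "c 1 3 - 4 * c 2 3 + 3 * c 3 3"
          "c 2 2 - 2 * c 2 3 + c 3 3" a b p]
      have "?v \<ge> 0" "?v = 0 \<Longrightarrow> a = 0 \<and> b = 0 \<and> p = 0"
        using z assms(2) unfolding penalizes_leaves_def by blast+
      then show ?thesis unfolding v using 3 by (auto simp: profile4_def q r)
    qed
  qed
  then show "profile_value c (profile4 n m) \<le> profile_value c (a, b, p, q, r)"
    and "profile_value c (profile4 n m) = profile_value c (a, b, p, q, r) \<Longrightarrow>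
           (real a, real b, real p, real q, real r) = profile4 n m" by blast+
qed

section \<open>Local modifications of graphs\<close>

text \<open>
  All existence results hold for an arbitrary vertex set of the right cardinality. New vertices are
  therefore always taken from the given set, and nothing has to be transported along isomorphisms.
\<close>

definition realizes :: "'a graph \<Rightarrow> 'a set \<Rightarrow> nat \<Rightarrow> bool" where
  "realizes G S m \<longleftrightarrow> simple_graph G \<and> connected_graph G \<and> verts G = S \<and> graph_size G = m"

definition attach :: "'a \<Rightarrow> 'a \<Rightarrow> 'a graph \<Rightarrow> 'a graph" where
  "attach x u G = (insert x (verts G), insert {u, x} (edges G))"

definition join :: "'a \<Rightarrow> 'a \<Rightarrow> 'a graph \<Rightarrow> 'a graph" where
  "join u v G = (verts G, insert {u, v} (edges G))"

definition subdivide :: "'a \<Rightarrow> 'a \<Rightarrow> 'a \<Rightarrow> 'a graph \<Rightarrow> 'a graph" where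
  "subdivide x u v G =
     (insert x (verts G), insert {u, x} (insert {v, x} (edges G - {{u, v}})))"

lemma edges_attach: "edges (attach x u G) = insert {u, x} (edges G)"
  and edges_join: "edges (join u v G) = insert {u, v} (edges G)"
  and edges_subdivide:
    "edges (subdivide x u v G) = insert {u, x} (insert {v, x} (edges G - {{u, v}}))"
  by (simp_all add: attach_def join_def subdivide_def)

lemma deg_insert_edge:
  assumes "finite E" "e \<notin> E"
  shows "deg (V, insert e E) w = deg (V', E) w + (if w \<in> e then 1 else 0)"
proof -
  have "{f \<in> insert e E. w \<in> f} = (if w \<in> e then insert e {f \<in> E. w \<in> f} else {f \<in> E. w \<in> f})"
    by auto
  then show ?thesis using assms by (simp add: deg_def)
qed

lemma deg_outside:
  assumes "simple_graph G" "v \<notin> verts G" shows "deg G v = 0"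
proof -
  have "{e \<in> edges G. v \<in> e} = {}" using assms by (auto simp: simple_graph_def)
  then show ?thesis by (simp only: deg_def card.empty)
qed

text \<open>
  Connectedness survives any modification that replaces old edges by walks and ties every new vertex
  to an old one; this covers all three modifications.
\<close>

lemma connected_extend:
  assumes "simple_graph G" "connected_graph G"
    and old: "\<And>u v. {u, v} \<in> edges G \<Longrightarrow> (u, v) \<in> {(x, y). {x, y} \<in> edges H}\<^sup>*"
    and new: "\<And>v. v \<in> verts H \<Longrightarrow> \<exists>u\<in>verts G. (u, v) \<in> {(x, y). {x, y} \<in> edges H}\<^sup>*"
    and "verts G \<subseteq> verts H"
  shows "connected_graph H"
proof -
  let ?r = "{(x, y). {x, y} \<in> edges H}"
  have sym: "(v, u) \<in> ?r\<^sup>*" if "(u, v) \<in> ?r\<^sup>*" for u v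
  proof -
    have "sym ?r" by (auto simp: sym_def insert_commute)
    then show ?thesis using that sym_rtrancl symD by metis
  qed
  have mono: "(u, v) \<in> ?r\<^sup>*" if "(u, v) \<in> {(x, y). {x, y} \<in> edges G}\<^sup>*" for u v
    using that
  proof induction
    case (step y z)
    then show ?case using old[of y z] by (simp add: rtrancl_trans)
  qed simp
  have "(u, v) \<in> ?r\<^sup>*" if uv: "u \<in> verts H" "v \<in> verts H" for u v
  proof -
    obtain u' v' where "u' \<in> verts G" "(u', u) \<in> ?r\<^sup>*" "v' \<in> verts G" "(v', v) \<in> ?r\<^sup>*"
      using new uv by metis
    moreover from this have "(u', v') \<in> ?r\<^sup>*"
      using mono assms(2) by (auto simp: connected_graph_def)
    ultimately show ?thesis using sym by (meson rtrancl_trans)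
  qed
  moreover have "verts H \<noteq> {}" using assms(2,5) by (auto simp: connected_graph_def)
  ultimately show ?thesis by (simp add: connected_graph_def)
qed

lemma attach:
  assumes "realizes G S m" "u \<in> S" "x \<notin> S"
  shows "realizes (attach x u G) (insert x S) (Suc m)"
    and "deg (attach x u G) = (deg G)(u := Suc (deg G u), x := 1)"
proof -
  let ?H = "attach x u G"
  have G: "simple_graph G" "connected_graph G" "verts G = S" "graph_size G = m"
    using assms by (auto simp: realizes_def)
  have new: "{u, x} \<notin> edges G" using simple_edgeD[OF G(1)] G(3) assms by blast
  note fE = finite_edges[OF G(1)]
  have "simple_graph ?H"
    using G assms by (auto simp: simple_graph_def attach_def card_2_iff)
  moreover have "connected_graph ?H"
  proof (rule connected_extend[OF G(1,2)])
    show "(p, q) \<in> {(x, y). {x, y} \<in> edges ?H}\<^sup>*" if "{p, q} \<in> edges G" for p q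
      using that by (intro r_into_rtrancl) (simp add: attach_def)
    show "\<exists>p\<in>verts G. (p, q) \<in> {(x, y). {x, y} \<in> edges ?H}\<^sup>*" if "q \<in> verts ?H" for q
    proof (cases "q = x")
      case True
      then have "(u, q) \<in> {(x, y). {x, y} \<in> edges ?H}" by (simp add: attach_def)
      then show ?thesis using assms G by blast
    next
      case False
      then show ?thesis using that by (auto simp: attach_def)
    qed
  qed (auto simp: attach_def)
  ultimately show "realizes ?H (insert x S) (Suc m)"
    using G new fE by (simp add: realizes_def attach_def graph_size_def)
  show "deg ?H = (deg G)(u := Suc (deg G u), x := 1)"
  proof
    fix w
    have "deg ?H w = deg G w + (if w \<in> {u, x} then 1 else 0)"
      unfolding attach_def by (subst deg_insert_edge[OF fE new, of _ _ "verts G"]) simp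
    then show "deg ?H w = ((deg G)(u := Suc (deg G u), x := 1)) w"
      using deg_outside[OF G(1), of x] G(3) assms by auto
  qed
qed

lemma join:
  assumes "realizes G S m" "u \<in> S" "v \<in> S" "u \<noteq> v" "{u, v} \<notin> edges G"
  shows "realizes (join u v G) S (Suc m)"
    and "deg (join u v G) = (deg G)(u := Suc (deg G u), v := Suc (deg G v))"
proof -
  let ?H = "join u v G"
  have G: "simple_graph G" "connected_graph G" "verts G = S" "graph_size G = m"
    using assms by (auto simp: realizes_def)
  note fE = finite_edges[OF G(1)]
  have "simple_graph ?H"
    using G assms by (auto simp: simple_graph_def join_def card_2_iff)
  moreover have "connected_graph ?H"
  proof (rule connected_extend[OF G(1,2)])
    show "(p, q) \<in> {(x, y). {x, y} \<in> edges ?H}\<^sup>*" if "{p, q} \<in> edges G" for p q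
      using that by (intro r_into_rtrancl) (simp add: join_def)
  qed (auto simp: join_def)
  ultimately show "realizes ?H S (Suc m)"
    using G assms fE by (simp add: realizes_def join_def graph_size_def)
  show "deg ?H = (deg G)(u := Suc (deg G u), v := Suc (deg G v))"
  proof
    fix w
    have "deg ?H w = deg G w + (if w \<in> {u, v} then 1 else 0)"
      unfolding join_def by (subst deg_insert_edge[OF fE assms(5), of _ _ "verts G"]) simp
    then show "deg ?H w = ((deg G)(u := Suc (deg G u), v := Suc (deg G v))) w"
      using assms by auto
  qed
qed

lemma subdivide:
  assumes "realizes G S m" "{u, v} \<in> edges G" "x \<notin> S"
  shows "realizes (subdivide x u v G) (insert x S) (Suc m)"
    and "deg (subdivide x u v G) = (deg G)(x := 2)"
proof -
  let ?H = "subdivide x u v G" and ?E = "edges G - {{u, v}}"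
  have G: "simple_graph G" "connected_graph G" "verts G = S" "graph_size G = m"
    using assms by (auto simp: realizes_def)
  note uv = simple_edgeD[OF G(1) assms(2)]
  have xn: "{p, x} \<notin> edges G" for p using simple_edgeD[OF G(1), of p x] G(3) assms by blast
  have new: "{v, x} \<notin> ?E" "{u, x} \<notin> insert {v, x} ?E"
    using xn uv by (auto simp: doubleton_eq_iff)
  have fE: "finite (edges G)" by (rule finite_edges[OF G(1)])
  let ?r = "{(x, y). {x, y} \<in> edges ?H}"
  have "simple_graph ?H"
    using G assms uv by (auto simp: simple_graph_def subdivide_def card_2_iff)
  moreover have "connected_graph ?H"
  proof (rule connected_extend[OF G(1,2)])
    have r: "(u, x) \<in> ?r" "(x, u) \<in> ?r" "(v, x) \<in> ?r" "(x, v) \<in> ?r"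
      by (simp_all add: subdivide_def insert_commute)
    show "(p, q) \<in> ?r\<^sup>*" if pq: "{p, q} \<in> edges G" for p q
    proof (cases "{p, q} = {u, v}")
      case True
      then have "p = u \<and> q = v \<or> p = v \<and> q = u" by (simp add: doubleton_eq_iff)
      then show ?thesis using r by (meson rtrancl.simps)
    next
      case False
      then show ?thesis using pq by (intro r_into_rtrancl) (simp add: subdivide_def)
    qed
    show "\<exists>p\<in>verts G. (p, q) \<in> ?r\<^sup>*" if "q \<in> verts ?H" for q
    proof (cases "q = x")
      case True
      then show ?thesis using uv r(1) by blast
    next
      case False
      then show ?thesis using that by (auto simp: subdivide_def)
    qed
  qed (auto simp: subdivide_def)
  moreover have "card (edges ?H) = Suc m"
  proof -
    have "card (edges ?H) = Suc (Suc (card ?E))"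
      unfolding subdivide_def using new fE by simp
    also have "Suc (card ?E) = card (edges G)"
      using assms(2) fE by (intro card_Suc_Diff1)
    finally show ?thesis using G by (simp add: graph_size_def)
  qed
  ultimately show "realizes ?H (insert x S) (Suc m)"
    using G by (simp add: realizes_def subdivide_def graph_size_def)
  show "deg ?H = (deg G)(x := 2)"
  proof
    fix w
    have eq: "insert {u, v} ?E = edges G" using assms(2) by auto
    have "deg G w = deg (verts G, insert {u, v} ?E) w" by (simp only: eq prod.collapse)
    also have "\<dots> = deg (verts G, ?E) w + (if w \<in> {u, v} then 1 else 0)"
      using fE by (intro deg_insert_edge) auto
    finally have 1: "deg G w = deg (verts G, ?E) w + (if w \<in> {u, v} then 1 else 0)" .
    have "deg ?H w = deg (verts G, insert {v, x} ?E) w + (if w \<in> {u, x} then 1 else 0)"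
      unfolding subdivide_def using fE new by (intro deg_insert_edge) auto
    also have "deg (verts G, insert {v, x} ?E) w
        = deg (verts G, ?E) w + (if w \<in> {v, x} then 1 else 0)"
      using fE new by (intro deg_insert_edge) auto
    finally have 2: "deg ?H w = deg (verts G, ?E) w + (if w \<in> {v, x} then 1 else 0)
        + (if w \<in> {u, x} then 1 else 0)" .
    show "deg ?H w = ((deg G)(x := 2)) w"
      using 1 2 uv G(3) assms(3) deg_outside[OF G(1), of x] by (cases "w = x") auto
  qed
qed

section \<open>Realizing the extremal degree patterns\<close>

lemma realizes_order: "realizes G S m \<Longrightarrow> graph_order G = card S"
  by (simp add: realizes_def graph_order_def)

lemma realizes_finite: "realizes G S m \<Longrightarrow> finite S"
  by (auto simp: realizes_def simple_graph_def)

lemma single_vertex: "realizes ({a}, {}) {a} 0"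
  by (auto simp: realizes_def simple_graph_def connected_graph_def graph_size_def)

lemma deg_single_vertex: "deg ({a}, {}) = (\<lambda>_. 0)"
  by (auto simp: deg_def)

lemma remove_point:
  assumes "card S = n" "n > 0"
  obtains x T where "S = insert x T" "x \<notin> T" "card T = n - 1"
proof -
  have "card S = Suc (n - 1)" using assms by simp
  then show thesis using that by (auto simp: card_Suc_eq)
qed

text \<open>
  A tree has an average degree below 2, so there is always a vertex of degree at most 1 to extend at.
\<close>

lemma path_exists:
  assumes "card S = Suc k"
  shows "\<exists>G. realizes G S k \<and> (\<forall>v\<in>S. deg G v \<le> 2)"
  using assms
proof (induction k arbitrary: S)
  case 0
  then obtain a where "S = {a}" by (auto simp: card_1_singleton_iff)
  then show ?case using single_vertex deg_single_vertex by (metis zero_le)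
next
  case (Suc k)
  then obtain x T where xT: "S = insert x T" "x \<notin> T" "card T = Suc k"
    by (metis card_Suc_eq)
  then obtain G where G: "realizes G T k" "\<forall>v\<in>T. deg G v \<le> 2" using Suc by blast
  have "2 * graph_size G < 2 * graph_order G"
    using G xT realizes_order[OF G(1)] by (simp add: realizes_def)
  moreover have "simple_graph G" "verts G = T" using G by (auto simp: realizes_def)
  ultimately obtain u where u: "u \<in> T" "deg G u < 2" using exists_small_degree by metis
  have "\<forall>v\<in>S. deg (attach x u G) v \<le> 2"
    unfolding attach(2)[OF G(1) u(1) xT(2)] using G(2) u xT by auto
  then show ?case using attach(1)[OF G(1) u(1) xT(2)] xT by blast
qed

lemma triangle_graph:
  assumes "distinct [a, b, c]"
  shows "\<exists>G. realizes G {a, b, c} 3 \<and> deg G = (\<lambda>_. 0)(a := 2, b := 2, c := 2) \<and>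
           edges G = {{a, b}, {b, c}, {a, c}}"
proof -
  let ?P = "({a}, {}) :: 'a graph"
  let ?Q = "attach b a ?P" let ?R = "attach c b ?Q" let ?G = "join a c ?R"
  have d: "a \<noteq> b" "a \<noteq> c" "b \<noteq> c" using assms by auto
  have Q: "realizes ?Q {b, a} 1" "deg ?Q = (\<lambda>_. 0)(a := 1, b := 1)"
    using attach[OF single_vertex, of a a b] d by (auto simp: deg_single_vertex)
  have R: "realizes ?R {c, b, a} 2" "deg ?R = (\<lambda>_. 0)(a := 1, b := 2, c := 1)"
    using attach[OF Q(1), of b c] d by (auto simp: Q(2) fun_eq_iff numeral_2_eq_2)
  have E: "edges ?R = {{a, b}, {b, c}}" by (auto simp: edges_attach)
  have "{a, c} \<notin> edges ?R" using d by (auto simp: E doubleton_eq_iff)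
  then have "realizes ?G {c, b, a} 3" "deg ?G = (\<lambda>_. 0)(a := 2, b := 2, c := 2)"
    using join[OF R(1), of a c] d by (auto simp: R(2) fun_eq_iff numeral_eq_Suc)
  moreover have "{c, b, a} = {a, b, c}" by auto
  moreover have "edges ?G = {{a, b}, {b, c}, {a, c}}" by (auto simp: edges_join E)
  ultimately show ?thesis by metis
qed

lemma diamond_graph:
  assumes "distinct [a, b, c, d]"
  shows "\<exists>G. realizes G {a, b, c, d} 5 \<and> deg G = (\<lambda>_. 0)(a := 2, b := 2, c := 3, d := 3) \<and>
           edges G = {{a, c}, {a, d}, {b, c}, {b, d}, {c, d}}"
proof -
  have d: "a \<noteq> b" "a \<noteq> c" "b \<noteq> c" "a \<noteq> d" "b \<noteq> d" "c \<noteq> d" using assms by auto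
  then obtain T where T: "realizes T {a, b, c} 3" "deg T = (\<lambda>_. 0)(a := 2, b := 2, c := 2)"
     "edges T = {{a, b}, {b, c}, {a, c}}" using triangle_graph[of a b c] by auto
  let ?Q = "subdivide d a b T" let ?G = "join c d ?Q"
  have Q: "realizes ?Q {d, a, b, c} 4" "deg ?Q = (\<lambda>_. 0)(a := 2, b := 2, c := 2, d := 2)"
    using subdivide[OF T(1), of a b d] d T by (auto simp: fun_eq_iff)
  have E: "edges ?Q = {{a, c}, {a, d}, {b, c}, {b, d}}"
    using d by (auto simp: edges_subdivide T(3) doubleton_eq_iff)
  have "{c, d} \<notin> edges ?Q" using d by (auto simp: E doubleton_eq_iff)
  then have "realizes ?G {d, a, b, c} 5" "deg ?G = (\<lambda>_. 0)(a := 2, b := 2, c := 3, d := 3)"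
    using join[OF Q(1), of c d] d by (auto simp: Q(2) fun_eq_iff numeral_eq_Suc)
  moreover have "{d, a, b, c} = {a, b, c, d}" by auto
  moreover have "edges ?G = {{a, c}, {a, d}, {b, c}, {b, d}, {c, d}}"
    by (auto simp: edges_join E)
  ultimately show ?thesis by metis
qed

lemma card_4_obtain:
  assumes "card S = 4"
  obtains a b c d where "S = {a, b, c, d}" "distinct [a, b, c, d]"
proof -
  have "finite S" using assms card.infinite by fastforce
  then obtain xs where xs: "set xs = S" "distinct xs" using finite_distinct_list by blast
  then have "length xs = 4" using assms distinct_card by metis
  then obtain a b c d where "xs = [a, b, c, d]"
    by (auto simp: numeral_eq_Suc length_Suc_conv)
  then show thesis using that[of a b c d] xs by simp
qed

text \<open>
  Start with the complete graph on 4 vertices; two more vertices are gained by subdividing two edges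
  and joining the two subdividing vertices.
\<close>

lemma cubic_exists:
  assumes "card S = 2 * k" "k \<ge> 2"
  shows "\<exists>G. realizes G S (3 * k) \<and> (\<forall>v\<in>S. deg G v = 3)"
  using assms(2,1)
proof (induction k arbitrary: S rule: dec_induct)
  case base
  then obtain a b c d where S: "S = {a, b, c, d}" and d: "distinct [a, b, c, d]"
    using card_4_obtain[of S] by (metis mult_2 numeral_Bit0)
  obtain D where D: "realizes D {a, b, c, d} 5"
    "deg D = (\<lambda>_. 0)(a := 2, b := 2, c := 3, d := 3)"
    "edges D = {{a, c}, {a, d}, {b, c}, {b, d}, {c, d}}" using diamond_graph[OF d] by metis
  have "{a, b} \<notin> edges D" using d by (auto simp: D(3) doubleton_eq_iff)
  then have "realizes (join a b D) S 6" "\<forall>v\<in>S. deg (join a b D) v = 3"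
    using join[OF D(1), of a b] d by (auto simp: S D(2))
  then show ?case by (intro exI[of _ "join a b D"]) simp
next
  case (step k)
  have fin: "finite S" using step.prems by (intro card_ge_0_finite) simp
  obtain x T' where x: "S = insert x T'" "x \<notin> T'" "card T' = Suc (2 * k)"
    using step.prems by (metis add_2_eq_Suc card_Suc_eq mult_Suc_right)
  obtain y T where y: "T' = insert y T" "y \<notin> T" "card T = 2 * k"
    using x(3) by (metis card_Suc_eq)
  obtain G where G: "realizes G T (3 * k)" "\<forall>v\<in>T. deg G v = 3"
    using step.IH[OF y(3)] by blast
  have sG: "simple_graph G" "verts G = T" "card (edges G) = 3 * k"
    using G(1) by (auto simp: realizes_def graph_size_def)
  have xT: "x \<notin> T" "x \<noteq> y" using x y by auto
  have "\<exists>e f. e \<in> edges G \<and> f \<in> edges G \<and> e \<noteq> f"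
  proof (rule ccontr)
    assume "\<not> ?thesis"
    then have "card (edges G) \<le> 1"
      using card_le_Suc0_iff_eq[OF finite_edges[OF sG(1)]] by auto
    then show False using sG step.hyps by simp
  qed
  then obtain u v p q where uv: "{u, v} \<in> edges G" and pq: "{p, q} \<in> edges G"
    and ne: "{p, q} \<noteq> {u, v}" using simple_edgeE[OF sG(1)] by metis
  note end1 = simple_edgeD[OF sG(1) uv, unfolded sG(2)]
  note end2 = simple_edgeD[OF sG(1) pq, unfolded sG(2)]
  let ?G1 = "subdivide x u v G" let ?G2 = "subdivide y p q ?G1" let ?G3 = "join x y ?G2"
  note G1 = subdivide[OF G(1) uv xT(1)]
  have pq1: "{p, q} \<in> edges ?G1" using pq ne by (simp add: edges_subdivide)
  have "y \<notin> insert x T" using y xT by auto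
  note G2 = subdivide[OF G1(1) pq1 this]
  have "{x, y} \<notin> edges G" using simple_edgeD[OF sG(1), of x y] sG xT by blast
  then have "{x, y} \<notin> edges ?G2"
    using end1 end2 xT y by (auto simp: edges_subdivide doubleton_eq_iff)
  then have G3: "realizes ?G3 (insert y (insert x T)) (Suc (Suc (Suc (3 * k))))"
    "deg ?G3 = (deg ?G2)(x := Suc (deg ?G2 x), y := Suc (deg ?G2 y))"
    using join[OF G2(1), of x y] xT by auto
  have "\<forall>v\<in>S. deg ?G3 v = 3"
    unfolding G3(2) G2(2) G1(2) using G(2) x y xT by auto
  moreover have "insert y (insert x T) = S" "Suc (Suc (Suc (3 * k))) = 3 * Suc k"
    using x y by auto
  then have "realizes ?G3 S (3 * Suc k)" using G3(1) by (simp only:)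
  ultimately show ?case by blast
qed

lemma realizes_subcubic:
  assumes "realizes G S m" "card S \<ge> 3" "\<forall>v\<in>S. deg G v \<le> 3"
  shows "subcubic G"
  using assms by (simp add: subcubic_def realizes_def graph_order_def)

lemma edge_count_zero:
  assumes "\<And>u v. {u, v} \<in> edges G \<Longrightarrow> deg G u = i \<Longrightarrow> deg G v = j \<Longrightarrow> False"
  shows "edge_count G i j = 0"
proof -
  have "typed_edges G i j = {}" using assms by (auto simp: typed_edges_def)
  then show ?thesis by (simp add: edge_count_card)
qed

lemma edge_count_pos:
  assumes "edge_count G i j > 0"
  obtains u v where "{u, v} \<in> edges G" "deg G u = i" "deg G v = j"
proof -
  have "typed_edges G i j \<noteq> {}" using assms unfolding edge_count_card by (metis card.empty less_irrefl)
  then show thesis using that by (auto simp: typed_edges_def)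
qed

text \<open>
  Subdividing an edge between two vertices of degree 3 keeps the vertices of degree 2 independent and
  changes neither \<open>m - n\<close> nor the degrees of the old vertices. So start with a cubic graph and subdivide
  one edge after another. By the two linear equations the number of (3,3)-edges is \<open>5 * m - 6 * n\<close>, so
  that they last exactly until \<open>5 * m = 6 * n\<close>. For \<open>m = n + 1\<close> there is no cubic simple graph to start
  with, and the complete graph on 4 vertices without an edge takes its place.
\<close>

lemma dense_core_exists:
  assumes "card S = n" "n \<ge> 4" "6 * n \<le> 5 * m" "2 * m \<le> 3 * n"
  shows "\<exists>G. realizes G S m \<and> (\<forall>v\<in>S. deg G v = 2 \<or> deg G v = 3) \<and>
           (\<forall>u v. {u, v} \<in> edges G \<longrightarrow> deg G u = 3 \<or> deg G v = 3)"
  using assms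
proof (induction n arbitrary: S m rule: less_induct)
  case (less n)
  consider "2 * m = 3 * n" | "n = 4" "m = 5" | "2 * m < 3 * n" "n > 4"
    using less.prems by linarith
  then show ?case
  proof cases
    case 1
    define k where "k = m - n"
    have k: "n = 2 * k" "m = 3 * k" "k \<ge> 2" using 1 less.prems by (auto simp: k_def)
    obtain G where G: "realizes G S m" "\<forall>v\<in>S. deg G v = 3"
      using cubic_exists[of S k] k less.prems by auto
    moreover have "\<forall>u v. {u, v} \<in> edges G \<longrightarrow> deg G u = 3 \<or> deg G v = 3"
      using G simple_edgeD[of G] unfolding realizes_def by blast
    ultimately show ?thesis by blast
  next
    case 2
    then obtain a b c d where S: "S = {a, b, c, d}" and d: "distinct [a, b, c, d]"
      using card_4_obtain[of S] less.prems(1) by metis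
    obtain D where D: "realizes D {a, b, c, d} 5"
      "deg D = (\<lambda>_. 0)(a := 2, b := 2, c := 3, d := 3)"
      "edges D = {{a, c}, {a, d}, {b, c}, {b, d}, {c, d}}" using diamond_graph[OF d] by metis
    have "\<forall>v\<in>S. deg D v = 2 \<or> deg D v = 3" using d by (simp add: D(2) S)
    moreover have "deg D u = 3 \<or> deg D v = 3" if "{u, v} \<in> edges D" for u v
      using that d unfolding D(2,3) by (auto simp: doubleton_eq_iff)
    ultimately show ?thesis using D(1) S 2 by blast
  next
    case 3
    obtain x T where x: "S = insert x T" "x \<notin> T" "card T = n - 1"
      using remove_point[OF less.prems(1)] 3 by auto
    have m: "m \<ge> 1" using less.prems by linarith
    have "\<exists>G. realizes G T (m - 1) \<and> (\<forall>v\<in>T. deg G v = 2 \<or> deg G v = 3) \<and>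
           (\<forall>u v. {u, v} \<in> edges G \<longrightarrow> deg G u = 3 \<or> deg G v = 3)"
      using 3 m less.prems x by (intro less.IH[of "n - 1"]) auto
    then obtain G where G: "realizes G T (m - 1)" "\<forall>v\<in>T. deg G v = 2 \<or> deg G v = 3"
      "\<And>u v. {u, v} \<in> edges G \<Longrightarrow> deg G u = 3 \<or> deg G v = 3" by blast
    have sG: "simple_graph G" "verts G = T" using G(1) by (auto simp: realizes_def)
    have sub: "subcubic G"
      using G x 3 by (intro realizes_subcubic[OF G(1)]) auto
    have z: "edge_count G 1 2 = 0" "edge_count G 1 3 = 0" "edge_count G 2 2 = 0"
      using G(2,3) simple_edgeD[OF sG(1)] sG(2) by (intro edge_count_zero; fastforce)+
    have "edge_count G 3 3 = 5 * (m - 1) - 6 * (n - 1)"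
      using subcubic_size_eq[OF sub] subcubic_order_eq[OF sub] G(1) x(3) unfolding z
      by (simp add: realizes_def graph_order_def)
    then have "edge_count G 3 3 > 0" using 3 less.prems by linarith
    then obtain u v where uv: "{u, v} \<in> edges G" "deg G u = 3" "deg G v = 3"
      by (rule edge_count_pos)
    note H = subdivide[OF G(1) uv(1) x(2)]
    note ends = simple_edgeD[OF sG(1)]
    have "\<forall>w\<in>S. deg (subdivide x u v G) w = 2 \<or> deg (subdivide x u v G) w = 3"
      unfolding H(2) using G(2) x by auto
    moreover have "deg (subdivide x u v G) p = 3 \<or> deg (subdivide x u v G) q = 3"
      if pq: "{p, q} \<in> edges (subdivide x u v G)" for p q
    proof -
      have "{p, q} = {u, x} \<or> {p, q} = {v, x} \<or> {p, q} \<in> edges G"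
        using pq by (auto simp: edges_subdivide)
      then show ?thesis unfolding H(2)
        using uv G(3)[of p q] ends[of p q] ends[OF uv(1)] sG(2) x(2) by (auto simp: doubleton_eq_iff)
    qed
    moreover have "realizes (subdivide x u v G) S m" using H(1) x(1) m by simp
    ultimately show ?thesis by blast
  qed
qed

text \<open>
  When \<open>5 * m = 6 * n\<close>, the graphs just constructed have no (3,3)-edges any more, so that the vertices
  of degree 3 are independent. Subdividing any edge keeps this property. Without vertices of degree 3
  the same procedure starts with a triangle.
\<close>

lemma sparse_core_exists:
  assumes "card S = n" "n \<ge> 3" "n \<le> m" "5 * m \<le> 6 * n"
  shows "\<exists>G. realizes G S m \<and> (\<forall>v\<in>S. deg G v = 2 \<or> deg G v = 3) \<and>
           (\<forall>u v. {u, v} \<in> edges G \<longrightarrow> deg G u = 2 \<or> deg G v = 2)"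
  using assms
proof (induction n arbitrary: S m rule: less_induct)
  case (less n)
  consider "5 * m = 6 * n" | "n = 3" "m = 3" | "5 * m < 6 * n" "n > 3"
    using less.prems by linarith
  then show ?case
  proof cases
    case 1
    then have "n \<ge> 4" "6 * n \<le> 5 * m" "2 * m \<le> 3 * n" using less.prems by presburger+
    then obtain G where G: "realizes G S m" "\<forall>v\<in>S. deg G v = 2 \<or> deg G v = 3"
      "\<And>u v. {u, v} \<in> edges G \<Longrightarrow> deg G u = 3 \<or> deg G v = 3"
      using dense_core_exists[OF less.prems(1)] by metis
    have sG: "simple_graph G" "verts G = S" using G(1) by (auto simp: realizes_def)
    have sub: "subcubic G"
      using G less.prems by (intro realizes_subcubic[OF G(1)]) auto
    have z: "edge_count G 1 2 = 0" "edge_count G 1 3 = 0" "edge_count G 2 2 = 0"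
      using G(2,3) simple_edgeD[OF sG(1)] sG(2) by (intro edge_count_zero; fastforce)+
    have z3: "edge_count G 3 3 = 0"
      using subcubic_size_eq[OF sub] subcubic_order_eq[OF sub] G(1) less.prems 1 unfolding z
      by (simp add: realizes_def graph_order_def)
    have "deg G u = 2 \<or> deg G v = 2" if "{u, v} \<in> edges G" for u v
    proof (rule ccontr)
      assume "\<not> ?thesis"
      then have "{u, v} \<in> typed_edges G 3 3"
        using that G(2) simple_edgeD[OF sG(1) that] sG(2) by (auto simp: typed_edges_def)
      then show False using z3 finite_edges[OF sG(1)]
        by (auto simp: edge_count_card card_eq_0_iff typed_edges_def)
    qed
    then show ?thesis using G by blast
  next
    case 2
    then have "card S = 3" using less.prems(1) by simp
    then obtain a b c where S: "S = {a, b, c}" and d: "distinct [a, b, c]"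
      by (auto simp: card_3_iff)
    obtain G where G: "realizes G {a, b, c} 3" "deg G = (\<lambda>_. 0)(a := 2, b := 2, c := 2)"
      "edges G = {{a, b}, {b, c}, {a, c}}" using triangle_graph[OF d] by metis
    have "\<forall>v\<in>S. deg G v = 2" using d by (simp add: G(2) S)
    moreover have "deg G u = 2 \<or> deg G v = 2" if "{u, v} \<in> edges G" for u v
      using that d unfolding G(2,3) by (auto simp: doubleton_eq_iff)
    ultimately show ?thesis using G(1) S 2 by blast
  next
    case 3
    obtain x T where x: "S = insert x T" "x \<notin> T" "card T = n - 1"
      using remove_point[OF less.prems(1)] 3 by auto
    have m: "m \<ge> 1" using less.prems by linarith
    have "\<exists>G. realizes G T (m - 1) \<and> (\<forall>v\<in>T. deg G v = 2 \<or> deg G v = 3) \<and>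
           (\<forall>u v. {u, v} \<in> edges G \<longrightarrow> deg G u = 2 \<or> deg G v = 2)"
      using 3 m less.prems x by (intro less.IH[of "n - 1"]) auto
    then obtain G where G: "realizes G T (m - 1)" "\<forall>v\<in>T. deg G v = 2 \<or> deg G v = 3"
      "\<And>u v. {u, v} \<in> edges G \<Longrightarrow> deg G u = 2 \<or> deg G v = 2" by blast
    have sG: "simple_graph G" "verts G = T" using G(1) by (auto simp: realizes_def)
    have "card (edges G) > 0"
      using G(1) 3 less.prems by (auto simp: realizes_def graph_size_def)
    then obtain e where "e \<in> edges G" by (auto simp: card_gt_0_iff)
    then obtain u v where uv: "{u, v} \<in> edges G" using simple_edgeE[OF sG(1)] by metis
    note H = subdivide[OF G(1) uv(1) x(2)]
    have "\<forall>w\<in>S. deg (subdivide x u v G) w = 2 \<or> deg (subdivide x u v G) w = 3"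
      unfolding H(2) using G(2) x by auto
    moreover have "deg (subdivide x u v G) p = 2 \<or> deg (subdivide x u v G) q = 2"
      if pq: "{p, q} \<in> edges (subdivide x u v G)" for p q
    proof -
      have "{p, q} = {u, x} \<or> {p, q} = {v, x} \<or> {p, q} \<in> edges G"
        using pq by (auto simp: edges_subdivide)
      then show ?thesis unfolding H(2)
        using G(3)[of p q] by (auto simp: doubleton_eq_iff)
    qed
    moreover have "realizes (subdivide x u v G) S m" using H(1) x(1) m by simp
    ultimately show ?thesis by blast
  qed
qed

text \<open>
  A pendant edge at each vertex of degree 2 removes this degree, since the vertex gets degree 3 and
  its new neighbour degree 1.
\<close>

lemma hang_leaves_on_degree_two:
  assumes "realizes G S m" "\<forall>v\<in>S. deg G v = 1 \<or> deg G v = 2 \<or> deg G v = 3"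
    and "finite U" "U \<inter> S = {}" "card U = card {v \<in> S. deg G v = 2}"
  shows "\<exists>H. realizes H (S \<union> U) (m + card U) \<and> (\<forall>v\<in>S \<union> U. deg H v = 1 \<or> deg H v = 3)"
  using assms(3,1,2,4,5)
proof (induction U arbitrary: G S m rule: finite_induct)
  case empty
  have "{v \<in> S. deg G v = 2} = {}"
    using empty realizes_finite[OF empty(1)] by (auto simp: card_eq_0_iff)
  then show ?case using empty by (intro exI[of _ G]) auto
next
  case (insert x U)
  have fS: "finite S" using insert.prems by (metis realizes_finite)
  have "card {v \<in> S. deg G v = 2} > 0" using insert by simp
  then obtain u where u: "u \<in> S" "deg G u = 2" by (auto simp: card_gt_0_iff)
  have xS: "x \<notin> S" using insert by auto
  note H = attach[OF insert.prems(1) u(1) xS]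
  have eq: "{v \<in> insert x S. deg (attach x u G) v = 2} = {v \<in> S. deg G v = 2} - {u}"
    unfolding H(2) using xS u by auto
  have "card U = card {v \<in> insert x S. deg (attach x u G) v = 2}"
    unfolding eq using insert fS u by simp
  moreover have "\<forall>v\<in>insert x S. deg (attach x u G) v = 1 \<or> deg (attach x u G) v = 2
      \<or> deg (attach x u G) v = 3"
    unfolding H(2) using insert.prems(2) u by auto
  moreover have "U \<inter> insert x S = {}" using insert by auto
  ultimately show ?case
    using insert.IH[OF H(1)] insert.hyps by simp
qed

lemma realizes_deg_sum:
  assumes "realizes G S m" shows "(\<Sum>v\<in>S. deg G v) = 2 * m"
  using assms handshake[of G] by (auto simp: realizes_def)

lemma sum_two_values:
  fixes f :: "'a \<Rightarrow> nat"
  assumes "finite S" "\<forall>v\<in>S. f v = i \<or> f v = 2" "i \<noteq> 2"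
  shows "(\<Sum>v\<in>S. f v) + i * card {v \<in> S. f v = 2} = i * card S + 2 * card {v \<in> S. f v = 2}"
proof -
  let ?A = "{v \<in> S. f v = 2}" and ?B = "{v \<in> S. f v = i}"
  have S: "S = ?A \<union> ?B" "?A \<inter> ?B = {}" using assms by auto
  have "(\<Sum>v\<in>S. f v) = sum f ?A + sum f ?B"
    using assms(1) S by (metis (no_types, lifting) finite_Un sum.union_disjoint)
  moreover have "sum f ?A = 2 * card ?A" "sum f ?B = i * card ?B" by simp_all
  moreover have "card S = card ?A + card ?B"
    using assms(1) S by (metis (no_types, lifting) card_Un_disjoint finite_Un)
  ultimately show ?thesis by (simp add: algebra_simps)
qed

text \<open>
  Hang leaves on a path if a tree is wanted, and on a graph with degrees 2 and 3 otherwise. Both kinds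
  of graphs are available with every suitable order and size.
\<close>

lemma leaf_cubic_exists:
  assumes "card S = n" "even n" "n \<ge> 6" "n \<le> m + 1" "2 * m + 2 \<le> 3 * n"
  shows "\<exists>G. realizes G S m \<and> (\<forall>v\<in>S. deg G v = 1 \<or> deg G v = 3)"
proof -
  obtain h where h: "n = 2 * h" using assms(2) by blast
  have "\<exists>k l c. k + c = n \<and> l + c = m \<and> (\<forall>T :: 'a set. card T = k \<longrightarrow> (\<exists>G. realizes G T l \<and>
      (\<forall>v\<in>T. deg G v = 1 \<or> deg G v = 2 \<or> deg G v = 3) \<and> card {v \<in> T. deg G v = 2} = c))"
  proof (cases "n = m + 1")
    case True
    have "\<exists>G. realizes G T h \<and> (\<forall>v\<in>T. deg G v = 1 \<or> deg G v = 2 \<or> deg G v = 3) \<and>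
        card {v \<in> T. deg G v = 2} = h - 1" if T: "card T = Suc h" for T :: "'a set"
    proof -
      obtain G where G: "realizes G T h" "\<forall>v\<in>T. deg G v \<le> 2" using path_exists[OF T] by blast
      have "\<forall>v\<in>T. deg G v \<ge> 1"
        using G(1) T h assms deg_pos[of G] by (auto simp: realizes_def graph_order_def)
      then have d: "\<forall>v\<in>T. deg G v = 1 \<or> deg G v = 2" using G(2) by fastforce
      have "2 * h + card {v \<in> T. deg G v = 2} = Suc h + 2 * card {v \<in> T. deg G v = 2}"
        using sum_two_values[OF realizes_finite[OF G(1)] d] realizes_deg_sum[OF G(1)] T by simp
      then show ?thesis using G(1) d by (intro exI[of _ G]) auto
    qed
    note path = this
    show ?thesis
    proof (rule exI[of _ "Suc h"], rule exI[of _ h], rule exI[of _ "h - 1"], intro conjI allI impI)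
      show "Suc h + (h - 1) = n" "h + (h - 1) = m" using True h assms by auto
    qed (rule path)
  next
    case False
    (* The solution of k + c = n, l + c = m and c = 3 * k - 2 * l, the number of vertices
       of degree 2 in a graph of order k and size l with degrees 2 and 3. *)
    define k where "k = m - h"
    define l where "l = 2 * m - 3 * h"
    define c where "c = 3 * h - m"
    have a: "h \<ge> 3" "2 * h \<le> m" "m < 3 * h" using False assms h by auto
    have kl: "k \<ge> 3" "k \<le> l" "2 * l \<le> 3 * k" "k + c = n" "l + c = m" "k = 3 \<Longrightarrow> l = 3"
      "c + 2 * l = 3 * k"
      using a h by (auto simp: k_def l_def c_def)
    have "\<exists>G. realizes G T l \<and> (\<forall>v\<in>T. deg G v = 1 \<or> deg G v = 2 \<or> deg G v = 3) \<and>
        card {v \<in> T. deg G v = 2} = c" if T: "card T = k" for T :: "'a set"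
    proof -
      have "\<exists>G. realizes G T l \<and> (\<forall>v\<in>T. deg G v = 2 \<or> deg G v = 3)"
      proof (cases "5 * l \<le> 6 * k")
        case True
        then show ?thesis using sparse_core_exists[OF T kl(1,2)] by blast
      next
        case False
        then have "k \<ge> 4" using kl by linarith
        then show ?thesis using dense_core_exists[OF T, of l] kl False by auto
      qed
      then obtain G where G: "realizes G T l" "\<forall>v\<in>T. deg G v = 3 \<or> deg G v = 2" by blast
      have "2 * l + 3 * card {v \<in> T. deg G v = 2} = 3 * k + 2 * card {v \<in> T. deg G v = 2}"
        using sum_two_values[OF realizes_finite[OF G(1)] G(2)] realizes_deg_sum[OF G(1)] T by simp
      then show ?thesis using G kl(7) by (intro exI[of _ G]) auto
    qed
    note core = this
    show ?thesis
    proof (rule exI[of _ k], rule exI[of _ l], rule exI[of _ c], intro conjI allI impI)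
      show "k + c = n" "l + c = m" by (fact kl)+
    qed (rule core)
  qed
  then obtain k l c where klc: "k + c = n" "l + c = m" and core: "\<And>T :: 'a set. card T = k \<Longrightarrow>
      \<exists>G. realizes G T l \<and> (\<forall>v\<in>T. deg G v = 1 \<or> deg G v = 2 \<or> deg G v = 3) \<and>
        card {v \<in> T. deg G v = 2} = c" by blast
  have fS: "finite S" using assms by (intro card_ge_0_finite) simp
  obtain T where T: "T \<subseteq> S" "card T = k"
    using obtain_subset_with_card_n[of k S] klc assms(1) by (metis le_add1)
  obtain G where G: "realizes G T l" "\<forall>v\<in>T. deg G v = 1 \<or> deg G v = 2 \<or> deg G v = 3"
    "card {v \<in> T. deg G v = 2} = c" using core[OF T(2)] by blast
  have cU: "card (S - T) = c"
    using T fS klc assms(1) by (simp add: card_Diff_subset finite_subset[OF T(1)])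
  have "T \<union> (S - T) = S" using T by auto
  then show ?thesis using hang_leaves_on_degree_two[OF G(1,2), of "S - T"] fS cU G(3) klc by auto
qed

section \<open>Extremal graphs\<close>

lemma chemical_subcubic:
  assumes "chemical_graph G"
  shows "subcubic G" "graph_order G \<ge> 7" "graph_order G \<le> graph_size G + 1"
    "2 * graph_size G + 3 \<le> 3 * graph_order G"
proof -
  have "real (2 * graph_size G + 3) \<le> real (3 * graph_order G)"
    using assms by (simp add: chemical_graph_def)
  then show "2 * graph_size G + 3 \<le> 3 * graph_order G" by (simp only: of_nat_le_iff)
  show "graph_order G \<le> graph_size G + 1"
    using assms by (intro connected_size_ge) (auto simp: chemical_graph_def)
qed (use assms in \<open>auto simp: chemical_graph_def subcubic_def\<close>)

lemma F3_profile:
  "F3 = {G. chemical_graph G \<and> edge_profile G = profile3 (graph_order G) (graph_size G)}"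
  by (auto simp: F3_def profile3_def Let_def)

lemma F4_profile:
  "F4 = {G. chemical_graph G \<and> edge_profile G = profile4 (graph_order G) (graph_size G)}"
proof -
  have "G \<in> F4 \<longleftrightarrow> edge_profile G = profile4 (graph_order G) (graph_size G)"
    if G: "chemical_graph G" for G :: "'a graph"
  proof -
    let ?n = "graph_order G" and ?m = "graph_size G"
    have b: "?n \<le> ?m + 1" "2 * ?m + 3 \<le> 3 * ?n" using chemical_subcubic[OF G] by auto
    have u: "real ?m \<le> (3 * real ?n - 3) / 2" using G by (simp add: chemical_graph_def)
    consider "?n = ?m + 1" | "?n \<le> ?m" "5 * ?m < 6 * ?n" | "?n \<le> ?m" "6 * ?n \<le> 5 * ?m"
      using b by linarith
    then show ?thesis
    proof cases
      case 1
      then have r: "real ?n = real ?m + 1" by simp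
      have "5 * ?m < 6 * ?n" using 1 by simp
      then have "real (5 * ?m) < real (6 * ?n)" by (simp only: of_nat_less_iff)
      then have "\<not> 6 * real ?n / 5 \<le> real ?m" "\<not> real ?n \<le> real ?m" using r by simp_all
      then show ?thesis using G 1 by (simp add: F4_def profile4_def Let_def)
    next
      case 2
      then have "real (5 * ?m) < real (6 * ?n)" "real ?n \<le> real ?m"
        by (simp_all only: of_nat_less_iff of_nat_le_iff)
      then show ?thesis using G 2 by (auto simp: F4_def profile4_def Let_def field_simps)
    next
      case 3
      then have "real (6 * ?n) \<le> real (5 * ?m)" "real ?n \<le> real ?m"
        by (simp_all only: of_nat_less_iff of_nat_le_iff)
      then show ?thesis using G 3 u by (auto simp: F4_def profile4_def Let_def field_simps)
    qed
  qed
  then show ?thesis by (auto simp: F4_def)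
qed

text \<open>
  For every admissible order and size, the two profiles are the only ones that can attain the largest
  and the smallest value of the index.
\<close>

lemma degree_index_bounds:
  fixes c :: "nat \<Rightarrow> nat \<Rightarrow> real"
  assumes "rewards_13_33 c" "penalizes_tree_branching c" "penalizes_leaves c"
    and "chemical_graph G"
  defines "n \<equiv> graph_order G" and "m \<equiv> graph_size G"
  shows "degree_index c G \<le> profile_value c (profile3 n m)"
    and "degree_index c G = profile_value c (profile3 n m) \<Longrightarrow> edge_profile G = profile3 n m"
    and "profile_value c (profile4 n m) \<le> degree_index c G"
    and "profile_value c (profile4 n m) = degree_index c G \<Longrightarrow> edge_profile G = profile4 n m"
proof -
  note G = chemical_subcubic[OF assms(4)]
  have o: "graph_order G \<ge> 5" using G by simp
  note eqs = subcubic_size_eq[OF G(1)] subcubic_order_eq[OF G(1)]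
  note upper = profile3_maximal[OF assms(1) eqs edges_12_le[OF G(1) o]]
  note lower = profile4_minimal[OF assms(2,3) eqs edges_13_le[OF G(1) o] G(3)]
  show "degree_index c G \<le> profile_value c (profile3 n m)"
    using upper(1) by (simp add: degree_index_profile n_def m_def edge_profile_def)
  show "edge_profile G = profile3 n m" if "degree_index c G = profile_value c (profile3 n m)"
    using upper(2) that by (simp add: degree_index_profile n_def m_def edge_profile_def)
  show "profile_value c (profile4 n m) \<le> degree_index c G"
    using lower(1) by (simp add: degree_index_profile n_def m_def edge_profile_def)
  show "edge_profile G = profile4 n m" if "profile_value c (profile4 n m) = degree_index c G"
    using lower(2) that by (simp add: degree_index_profile n_def m_def edge_profile_def)
qed

lemma realizes_chemical:
  assumes "realizes G S m" "card S \<ge> 7" "2 * m + 3 \<le> 3 * card S" "\<forall>v\<in>S. deg G v \<le> 3"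
  shows "chemical_graph G" "graph_order G = card S" "graph_size G = m"
proof -
  have "real (2 * m + 3) \<le> real (3 * card S)" using assms(3) by (simp only: of_nat_le_iff)
  then show "chemical_graph G"
    using assms by (auto simp: chemical_graph_def realizes_def graph_order_def)
qed (use assms in \<open>auto simp: realizes_def graph_order_def\<close>)

text \<open>
  If the order is odd, take a graph with one vertex less and degrees 1 and 3, and hang a new leaf on
  one of its leaves, which becomes the only vertex of degree 2. It has only two edges, and by
  \<open>edges_12_le\<close> they cannot both be of type (1,2).
\<close>

lemma profile3_exists:
  assumes "card S = n" "n \<ge> 7" "n \<le> m + 1" "2 * m + 3 \<le> 3 * n"
  shows "\<exists>G. chemical_graph G \<and> verts G = S \<and> graph_size G = m \<and> edge_profile G = profile3 n m"
proof (cases "even n")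
  case True
  then have "2 * m + 2 \<le> 3 * n" "n \<ge> 6" using assms by auto
  then obtain G where G: "realizes G S m" "\<forall>v\<in>S. deg G v = 1 \<or> deg G v = 3"
    using leaf_cubic_exists[OF assms(1) True _ assms(3)] by blast
  have "\<forall>v\<in>S. deg G v \<le> 3" using G(2) by auto
  then have chem: "chemical_graph G" "graph_order G = n" "graph_size G = m"
    using realizes_chemical[OF G(1)] assms by simp_all
  note sub = chemical_subcubic(1)[OF chem(1)]
  have sG: "simple_graph G" "verts G = S" using G(1) by (auto simp: realizes_def)
  have z: "edge_count G 1 2 = 0" "edge_count G 2 2 = 0" "edge_count G 2 3 = 0"
    using G(2) simple_edgeD[OF sG(1)] sG(2) by (intro edge_count_zero; fastforce)+
  have "edge_profile G = profile3 n m"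
    using arg_cong[OF subcubic_size_eq[OF sub], of real]
      arg_cong[OF subcubic_order_eq[OF sub], of real] True
    unfolding edge_profile_def profile3_def z chem by (simp add: field_simps)
  then show ?thesis using chem sG by blast
next
  case False
  obtain x T where x: "S = insert x T" "x \<notin> T" "card T = n - 1"
    using remove_point[OF assms(1)] assms(2) by auto
  have ev: "even (n - 1)" "n - 1 \<ge> 6" "n - 1 \<le> (m - 1) + 1" "2 * (m - 1) + 2 \<le> 3 * (n - 1)"
    using False assms by auto
  have m: "Suc (m - 1) = m" using assms by simp
  obtain G where G: "realizes G T (m - 1)" "\<forall>v\<in>T. deg G v = 1 \<or> deg G v = 3"
    using leaf_cubic_exists[OF x(3) ev] by blast
  have sG: "simple_graph G" "verts G = T" using G(1) by (auto simp: realizes_def)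
  have "2 * graph_size G < 3 * graph_order G"
    using G(1) x(3) ev by (simp add: realizes_def graph_order_def)
  then obtain u where u: "u \<in> T" "deg G u < 3" using exists_small_degree[OF sG(1)] sG(2) by metis
  then have u1: "deg G u = 1" using G(2) by auto
  let ?H = "attach x u G"
  have H: "realizes ?H S m" "deg ?H = (deg G)(u := 2, x := 1)"
    using attach[OF G(1) u(1) x(2)] u1 m x(1) by (simp_all add: numeral_2_eq_2)
  have dH: "deg ?H v = 2 \<longleftrightarrow> v = u" if "v \<in> S" for v
    unfolding H(2) using that G(2) x u by auto
  have "\<forall>v\<in>S. deg ?H v \<le> 3"
    unfolding H(2) using G(2) x by auto
  then have chem: "chemical_graph ?H" "graph_order ?H = n" "graph_size ?H = m"
    using realizes_chemical[OF H(1)] assms by simp_all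
  note sub = chemical_subcubic(1)[OF chem(1)]
  have sH: "simple_graph ?H" "verts ?H = S" using H(1) by (auto simp: realizes_def)
  have z: "edge_count ?H 2 2 = 0"
    using dH simple_edgeD[OF sH(1)] sH(2) by (intro edge_count_zero) metis
  have "{u, x} \<in> typed_edges ?H 1 2"
  proof -
    have "deg ?H x = 1" "deg ?H u = 2" using u x(2) by (auto simp: H(2))
    then have "{u, x} = {x, u} \<and> deg ?H x = 1 \<and> deg ?H u = 2" by auto
    then show ?thesis unfolding typed_edges_def edges_attach by blast
  qed
  then have p: "edge_count ?H 1 2 \<ge> 1"
    using finite_edges[OF sH(1)]
    by (auto simp: edge_count_card Suc_le_eq card_gt_0_iff typed_edges_def)
  have le: "edge_count ?H 1 2 \<le> edge_count ?H 2 3"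
    using edges_12_le[OF sub] chem assms z by simp
  have two: "edge_count ?H 1 2 + edge_count ?H 2 3 \<le> 2"
  proof -
    have "p = u" if "{p, q} \<in> edges ?H" "deg ?H p = 2" for p q
      using that dH simple_edgeD(2)[OF sH(1)] sH(2) by blast
    then have "typed_edges ?H 1 2 \<union> typed_edges ?H 2 3 \<subseteq> {e \<in> edges ?H. u \<in> e}"
      unfolding typed_edges_def by (fastforce simp: insert_commute)
    then have "card (typed_edges ?H 1 2 \<union> typed_edges ?H 2 3) \<le> deg ?H u"
      unfolding deg_def using finite_edges[OF sH(1)] by (intro card_mono) auto
    moreover have "card (typed_edges ?H 1 2 \<union> typed_edges ?H 2 3)
        = edge_count ?H 1 2 + edge_count ?H 2 3"
      unfolding edge_count_card using finite_edges[OF sH(1)]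
      by (intro card_Un_disjoint typed_edges_disjoint) (auto simp: typed_edges_def)
    moreover have "deg ?H u = 2" using dH u x by simp
    ultimately show ?thesis by simp
  qed
  have c: "edge_count ?H 1 2 = 1" "edge_count ?H 2 3 = 1" using p le two by linarith+
  have "edge_profile ?H = profile3 n m"
    using arg_cong[OF subcubic_size_eq[OF sub], of real]
      arg_cong[OF subcubic_order_eq[OF sub], of real] False
    unfolding edge_profile_def profile3_def z c chem by (simp add: field_simps)
  then show ?thesis using chem sH by blast
qed

text \<open>
  Each of the three constructions excludes three edge types, and the two linear equations determine
  the other two counts.
\<close>

lemma profile4_exists:
  assumes "card S = n" "n \<ge> 7" "n \<le> m + 1" "2 * m + 3 \<le> 3 * n"
  shows "\<exists>G. chemical_graph G \<and> verts G = S \<and> graph_size G = m \<and> edge_profile G = profile4 n m"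
proof -
  consider "n = m + 1" | "n \<le> m" "5 * m < 6 * n" | "n \<le> m" "6 * n \<le> 5 * m"
    using assms by linarith
  then show ?thesis
  proof cases
    case 1
    then obtain G where G: "realizes G S m" "\<forall>v\<in>S. deg G v \<le> 2"
      using path_exists[of S m] assms(1) by auto
    have "\<forall>v\<in>S. deg G v \<le> 3" using G(2) by auto
    then have chem: "chemical_graph G" "graph_order G = n" "graph_size G = m"
      using realizes_chemical[OF G(1)] assms by simp_all
    note sub = chemical_subcubic(1)[OF chem(1)]
    have sG: "simple_graph G" "verts G = S" using G(1) by (auto simp: realizes_def)
    have z: "edge_count G 1 3 = 0" "edge_count G 2 3 = 0" "edge_count G 3 3 = 0"
      using G(2) simple_edgeD[OF sG(1)] sG(2) by (intro edge_count_zero; fastforce)+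
    have "edge_profile G = profile4 n m"
      using arg_cong[OF subcubic_size_eq[OF sub], of real]
        arg_cong[OF subcubic_order_eq[OF sub], of real] 1
      unfolding edge_profile_def profile4_def z chem by (simp add: field_simps)
    then show ?thesis using chem sG by blast
  next
    case 2
    then obtain G where G: "realizes G S m" "\<forall>v\<in>S. deg G v = 2 \<or> deg G v = 3"
      "\<And>u v. {u, v} \<in> edges G \<Longrightarrow> deg G u = 2 \<or> deg G v = 2"
      using sparse_core_exists[OF assms(1), of m] assms by auto
    have "\<forall>v\<in>S. deg G v \<le> 3" using G(2) by auto
    then have chem: "chemical_graph G" "graph_order G = n" "graph_size G = m"
      using realizes_chemical[OF G(1)] assms by simp_all
    note sub = chemical_subcubic(1)[OF chem(1)]
    have sG: "simple_graph G" "verts G = S" using G(1) by (auto simp: realizes_def)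
    have z: "edge_count G 1 2 = 0" "edge_count G 1 3 = 0" "edge_count G 3 3 = 0"
      using G(2,3) simple_edgeD[OF sG(1)] sG(2) by (intro edge_count_zero; fastforce)+
    have "edge_profile G = profile4 n m"
      using arg_cong[OF subcubic_size_eq[OF sub], of real]
        arg_cong[OF subcubic_order_eq[OF sub], of real] 2
      unfolding edge_profile_def profile4_def z chem by (simp add: field_simps)
    then show ?thesis using chem sG by blast
  next
    case 3
    then obtain G where G: "realizes G S m" "\<forall>v\<in>S. deg G v = 2 \<or> deg G v = 3"
      "\<And>u v. {u, v} \<in> edges G \<Longrightarrow> deg G u = 3 \<or> deg G v = 3"
      using dense_core_exists[OF assms(1), of m] assms by auto
    have "\<forall>v\<in>S. deg G v \<le> 3" using G(2) by auto
    then have chem: "chemical_graph G" "graph_order G = n" "graph_size G = m"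
      using realizes_chemical[OF G(1)] assms by simp_all
    note sub = chemical_subcubic(1)[OF chem(1)]
    have sG: "simple_graph G" "verts G = S" using G(1) by (auto simp: realizes_def)
    have z: "edge_count G 1 2 = 0" "edge_count G 1 3 = 0" "edge_count G 2 2 = 0"
      using G(2,3) simple_edgeD[OF sG(1)] sG(2) by (intro edge_count_zero; fastforce)+
    have "edge_profile G = profile4 n m"
      using arg_cong[OF subcubic_size_eq[OF sub], of real]
        arg_cong[OF subcubic_order_eq[OF sub], of real] 3
      unfolding edge_profile_def profile4_def z chem by (simp add: field_simps)
    then show ?thesis using chem sG by blast
  qed
qed

theorem corollary10:
  fixes idx :: index_name
  shows "{G :: 'a graph. extremal_for (degree_index (index_coeff idx)) G} = F3 \<union> F4"
proof -
  let ?c = "index_coeff idx" let ?f = "degree_index ?c"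
  note bounds = degree_index_bounds[OF index_coeff_conditions, of _ idx]
  let ?same = "\<lambda>(G :: 'a graph) (H :: 'a graph). chemical_graph H \<and> graph_order H = graph_order G \<and>
      graph_size H = graph_size G"
  have max_iff: "(\<forall>H. ?same G H \<longrightarrow> ?f H \<le> ?f G) \<longleftrightarrow>
      edge_profile G = profile3 (graph_order G) (graph_size G)" (is "?L \<longleftrightarrow> ?R")
    and min_iff: "(\<forall>H. ?same G H \<longrightarrow> ?f G \<le> ?f H) \<longleftrightarrow>
      edge_profile G = profile4 (graph_order G) (graph_size G)" (is "?L' \<longleftrightarrow> ?R'")
    if G: "chemical_graph G" for G :: "'a graph"
  proof -
    have card: "card (verts G) = graph_order G" by (simp add: graph_order_def)
    note ex = profile3_exists[OF card chemical_subcubic(2-4)[OF G]]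
      profile4_exists[OF card chemical_subcubic(2-4)[OF G]]
    show "?L \<longleftrightarrow> ?R"
    proof
      assume L: ?L
      obtain H where "chemical_graph H" "verts H = verts G" "graph_size H = graph_size G"
        and H: "edge_profile H = profile3 (graph_order G) (graph_size G)"
        using ex(1) by blast
      then have "?same G H" by (simp add: graph_order_def)
      with H have "profile_value ?c (profile3 (graph_order G) (graph_size G)) \<le> ?f G"
        using L by (metis degree_index_profile)
      then show ?R using bounds(1,2)[OF G] by (metis order_antisym)
    next
      assume ?R
      then show ?L using bounds(1) by (metis degree_index_profile)
    qed
    show "?L' \<longleftrightarrow> ?R'"
    proof
      assume L: ?L'
      obtain H where "chemical_graph H" "verts H = verts G" "graph_size H = graph_size G"
        and H: "edge_profile H = profile4 (graph_order G) (graph_size G)"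
        using ex(2) by blast
      then have "?same G H" by (simp add: graph_order_def)
      with H have "?f G \<le> profile_value ?c (profile4 (graph_order G) (graph_size G))"
        using L by (metis degree_index_profile)
      then show ?R' using bounds(3,4)[OF G] by (metis order_antisym)
    next
      assume ?R'
      then show ?L' using bounds(3) by (metis degree_index_profile)
    qed
  qed
  show ?thesis
    unfolding F3_profile F4_profile extremal_for_def using max_iff min_iff by blast
qed

end
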